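(* Let $\Omega\subset\mathbb C^m$ be the open unit ball of a norm $\|\cdot\|_\Omega$ on $\mathbb C^m$. For $n\ge 1$ and $V=(V_1,\dots,V_m)$ with $V_j\in\mathbb C^{1\times n}$, let $\varrho_V$ be the associated little Parrott homomorphism on $H^\infty(\Omega)$ (at the point $w=0$). If $\varrho_V$ is contractive, then $$\|\varrho_V\|_{cb}\le\sqrt{\gamma(\mathbb C^m,\|\cdot\|_\Omega)}.$$ Furthermore, the upper bound is attained by some contractive little Parrott homomorphism: there exist $n$ and $V\in(\mathbb C^{1\times n})^m$ with $\varrho_V$ contractive and $\|\varrho_V\|_{cb}=\sqrt{\gamma(\mathbb C^m,\|\cdot\|_\Omega)}$.
   Context: All spaces are complex. $H^\infty(\Omega)$ is the algebra of bounded holomorphic functions on $\Omega$ with the sup norm. Little Parrott homomorphism: for $V=(V_1,\dots,V_m)$, $V_j\in\mathbb C^{1\times n}$ (row vectors $v_j$), $\varrho_V:H^\infty(\Omega)\to\mathbb C^{(n+1)\times(n+1)}$ is the homomorphism $$\varrho_V(f)=\begin{pmatrix} f(0)& Df(0)\cdot V\\0&f(0)I_n\end{pmatrix},\qquad Df(0)\cdot V=\sum_{j=1}^m\frac{\partial f}{\partial z_j}(0)V_j .$$ Matrices carry the operator norm between $\ell_2$ spaces. Set $\varrho_V^{(k)}=\varrho_V\otimes I_k: H^\infty(\Omega)\otimes\mathbb C^{k\times k}\to\mathbb C^{(n+1)k\times(n+1)k}$, where $f\in H^\infty(\Omega)\otimes\mathbb C^{k\times k}$ has norm $\sup_{z\in\Omega}\|f(z)\|_{\ell_2^k\to\ell_2^k}$.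 $\varrho_V$ is contractive if $\|\varrho_V\|\le1$, and $\|\varrho_V\|_{cb}=\sup_{k\ge1}\|\varrho_V^{(k)}\|$. The constant $\gamma$: for $E=(\mathbb C^m,\|\cdot\|)$ with dual norm $\|x\|_*=\sup\{|\sum_j x_jz_j|:\|z\|\le1\}$, $\gamma(E)$ is the infimum of all $c$ such that $$\sum_{i,j}a_{ij}b_{ij}\le c\,\|A\|_\vee\|B\|_\vee$$ for all positive semidefinite $m\times m$ matrices $A=(a_{ij})$, $B=(b_{ij})$, where $\|A\|_\vee=\sup\{|\sum a_{ij}x_i\overline{y_j}|:\|x\|_*,\|y\|_*\le1\}$ (injective norm for $E$) and $\|B\|_\vee=\sup\{|\sum b_{ij}z_i\overline{w_j}|:\|z\|,\|w\|\le1\}$ (injective norm for $E^*$). *)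

theory Defs
  imports "HOL-Analysis.Analysis" "Jordan_Normal_Form.Matrix"
begin

no_notation vec_index (infixl \<open>$\<close> 100)

text \<open>
  The ambient dimension is the fixed finite index type \<open>'m\<close>, so \<open>\<complex>\<^sup>m\<close> is the type
  \<open>complex ^ 'm\<close>. The sizes \<open>n\<close> and \<open>k\<close> are quantified over, so matrices of these sizes are
  \<open>complex mat\<close> with explicit carriers.
\<close>

subsection \<open>Norms on \<open>\<complex>\<^sup>m\<close>, their duals and unit balls\<close>

definition is_norm :: "(complex ^ 'm \<Rightarrow> real) \<Rightarrow> bool" where
  "is_norm N \<longleftrightarrow>
     (\<forall>z. 0 \<le> N z) \<and> (\<forall>z. N z = 0 \<longrightarrow> z = 0) \<and>
     (\<forall>c z. N (c *s z) = cmod c * N z) \<and> (\<forall>z w. N (z + w) \<le> N z + N w)"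

definition unit_ball :: "(complex ^ 'm \<Rightarrow> real) \<Rightarrow> (complex ^ 'm) set" where
  "unit_ball N = {z. N z < 1}"

definition dual_norm :: "(complex ^ 'm \<Rightarrow> real) \<Rightarrow> complex ^ 'm \<Rightarrow> real" where
  "dual_norm N x = (SUP z \<in> {z. N z \<le> 1}. cmod (\<Sum>j\<in>UNIV. x $ j * z $ j))"

subsection \<open>The constant \<open>\<gamma>\<close>\<close>

definition psd :: "complex ^ 'm ^ 'm \<Rightarrow> bool" where
  "psd A \<longleftrightarrow>
     (\<forall>i j. A $ i $ j = cnj (A $ j $ i)) \<and>
     (\<forall>x :: complex ^ 'm. 0 \<le> Re (\<Sum>i\<in>UNIV. \<Sum>j\<in>UNIV. cnj (x $ i) * A $ i $ j * x $ j))"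

text \<open>
  \<open>sesq_sup M A\<close> is the supremum of the sesquilinear form of \<open>A\<close> over the unit ball of \<open>M\<close>. The
  injective norm for \<open>E = (\<complex>\<^sup>m, N)\<close> is \<open>sesq_sup (dual_norm N)\<close>, that for \<open>E\<^sup>*\<close> is \<open>sesq_sup N\<close>.
\<close>

definition sesq_sup :: "(complex ^ 'm \<Rightarrow> real) \<Rightarrow> complex ^ 'm ^ 'm \<Rightarrow> real" where
  "sesq_sup M A =
     (SUP (x, y) \<in> {x. M x \<le> 1} \<times> {y. M y \<le> 1}.
        cmod (\<Sum>i\<in>UNIV. \<Sum>j\<in>UNIV. A $ i $ j * x $ i * cnj (y $ j)))"

text \<open>
  For positive semidefinite \<open>A\<close>, \<open>B\<close> the sum of the products \<open>a\<^sub>i\<^sub>j b\<^sub>i\<^sub>j\<close> is a real number, hence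
  equal to its real part. For a norm \<open>N\<close> the set of admissible \<open>c\<close> is nonempty and bounded below
  by \<open>0\<close>, so the real infimum is the intended one.
\<close>

definition gamma_const :: "(complex ^ 'm \<Rightarrow> real) \<Rightarrow> real" where
  "gamma_const N = Inf {c :: real. \<forall>A B. psd A \<longrightarrow> psd B \<longrightarrow>
     Re (\<Sum>i\<in>UNIV. \<Sum>j\<in>UNIV. A $ i $ j * B $ i $ j)
       \<le> c * sesq_sup (dual_norm N) A * sesq_sup N B}"

subsection \<open>Operator norm of matrices\<close>

definition l2_norm :: "complex Matrix.vec \<Rightarrow> real" where
  "l2_norm v = L2_set (\<lambda>i. cmod (vec_index v i)) {..<dim_vec v}"

definition op_norm :: "complex mat \<Rightarrow> real" where
  "op_norm A = (SUP v \<in> {v \<in> carrier_vec (dim_col A). l2_norm v \<le> 1}. l2_norm (A *\<^sub>v v))"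

subsection \<open>Bounded holomorphic functions in several variables\<close>

text \<open>
  Functions are total; only their restriction to the open set \<open>\<Omega>\<close> matters. Holomorphic means
  Frechet differentiable with complex-linear derivative at every point of \<open>\<Omega>\<close>.
\<close>

definition holomorphic_sev :: "(complex ^ 'm \<Rightarrow> complex) \<Rightarrow> (complex ^ 'm) set \<Rightarrow> bool" where
  "holomorphic_sev f \<Omega> \<longleftrightarrow>
     (\<forall>z\<in>\<Omega>. \<exists>D. (f has_derivative D) (at z) \<and> (\<forall>c w. D (c *s w) = c * D w))"

definition H_inf :: "(complex ^ 'm) set \<Rightarrow> (complex ^ 'm \<Rightarrow> complex) set" where
  "H_inf \<Omega> = {f. holomorphic_sev f \<Omega> \<and> bounded (f ` \<Omega>)}"

definition H_inf_norm :: "(complex ^ 'm) set \<Rightarrow> (complex ^ 'm \<Rightarrow> complex) \<Rightarrow> real" where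
  "H_inf_norm \<Omega> f = (SUP z\<in>\<Omega>. cmod (f z))"

text \<open>\<open>H\<^sup>\<infinity>(\<Omega>) \<otimes> \<complex>\<^sup>k\<^sup>\<times>\<^sup>k\<close>, as \<open>k \<times> k\<close> matrix valued functions with entries in \<open>H\<^sup>\<infinity>(\<Omega>)\<close>\<close>

definition H_inf_mat :: "nat \<Rightarrow> (complex ^ 'm) set \<Rightarrow> (complex ^ 'm \<Rightarrow> complex mat) set" where
  "H_inf_mat k \<Omega> =
     {F. (\<forall>z\<in>\<Omega>. F z \<in> carrier_mat k k) \<and> (\<forall>p<k. \<forall>q<k. (\<lambda>z. F z $$ (p, q)) \<in> H_inf \<Omega>)}"

definition H_inf_mat_norm :: "(complex ^ 'm) set \<Rightarrow> (complex ^ 'm \<Rightarrow> complex mat) \<Rightarrow> real" where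
  "H_inf_mat_norm \<Omega> F = (SUP z\<in>\<Omega>. op_norm (F z))"

subsection \<open>Little Parrott homomorphisms\<close>

definition partial_at_0 :: "'m \<Rightarrow> (complex ^ 'm \<Rightarrow> complex) \<Rightarrow> complex" where
  "partial_at_0 j f = deriv (\<lambda>t. f (axis j t)) 0"

definition Df0_dot :: "nat \<Rightarrow> ('m::finite \<Rightarrow> complex mat) \<Rightarrow> (complex ^ 'm \<Rightarrow> complex) \<Rightarrow> complex mat"
  where "Df0_dot n V f = Matrix.mat 1 n (\<lambda>pq. \<Sum>j\<in>UNIV. partial_at_0 j f * V j $$ pq)"

definition little_parrott ::
    "nat \<Rightarrow> ('m::finite \<Rightarrow> complex mat) \<Rightarrow> (complex ^ 'm \<Rightarrow> complex) \<Rightarrow> complex mat" where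
  "little_parrott n V f =
     four_block_mat (f 0 \<cdot>\<^sub>m 1\<^sub>m 1) (Df0_dot n V f) (0\<^sub>m n 1) (f 0 \<cdot>\<^sub>m 1\<^sub>m n)"

text \<open>
  \<open>\<rho>\<^sub>V \<otimes> I\<^sub>k\<close>: writing \<open>F\<close> as the sum of \<open>F\<^sub>p\<^sub>q \<otimes> E\<^sub>p\<^sub>q\<close> over the matrix units \<open>E\<^sub>p\<^sub>q\<close>, the value is the
  sum of the Kronecker products \<open>\<rho>\<^sub>V(F\<^sub>p\<^sub>q) \<otimes> E\<^sub>p\<^sub>q\<close>; the index \<open>(a, p)\<close> of \<open>\<complex>\<^sup>n\<^sup>+\<^sup>1 \<otimes> \<complex>\<^sup>k\<close> is
  encoded as \<open>a * k + p\<close>.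
\<close>

definition little_parrott_amp ::
    "nat \<Rightarrow> ('m::finite \<Rightarrow> complex mat) \<Rightarrow> nat \<Rightarrow> (complex ^ 'm \<Rightarrow> complex mat) \<Rightarrow> complex mat" where
  "little_parrott_amp n V k F =
     Matrix.mat ((n + 1) * k) ((n + 1) * k)
       (\<lambda>(i, j). little_parrott n V (\<lambda>z. F z $$ (i mod k, j mod k)) $$ (i div k, j div k))"

text \<open>The norms of linear maps are extended reals, so that no boundedness is presupposed.\<close>

definition little_parrott_norm ::
    "(complex ^ 'm) set \<Rightarrow> nat \<Rightarrow> ('m::finite \<Rightarrow> complex mat) \<Rightarrow> ereal" where
  "little_parrott_norm \<Omega> n V =
     (SUP f \<in> {f \<in> H_inf \<Omega>. H_inf_norm \<Omega> f \<le> 1}. ereal (op_norm (little_parrott n V f)))"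

definition little_parrott_amp_norm ::
    "(complex ^ 'm) set \<Rightarrow> nat \<Rightarrow> ('m::finite \<Rightarrow> complex mat) \<Rightarrow> nat \<Rightarrow> ereal" where
  "little_parrott_amp_norm \<Omega> n V k =
     (SUP F \<in> {F \<in> H_inf_mat k \<Omega>. H_inf_mat_norm \<Omega> F \<le> 1}.
        ereal (op_norm (little_parrott_amp n V k F)))"

definition contractive ::
    "(complex ^ 'm) set \<Rightarrow> nat \<Rightarrow> ('m::finite \<Rightarrow> complex mat) \<Rightarrow> bool" where
  "contractive \<Omega> n V \<longleftrightarrow> little_parrott_norm \<Omega> n V \<le> 1"

definition cb_norm ::
    "(complex ^ 'm) set \<Rightarrow> nat \<Rightarrow> ('m::finite \<Rightarrow> complex mat) \<Rightarrow> ereal" where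
  "cb_norm \<Omega> n V = (SUP k \<in> {1..}. little_parrott_amp_norm \<Omega> n V k)"

end

theory Submission
  imports Defs "HOL-Complex_Analysis.Conformal_Mappings" "Jordan_Normal_Form.Determinant"
begin

no_notation vec_index (infixl \<open>$\<close> 100)

text \<open>
  Write \<open>a\<^sub>i\<^sub>j = V\<^sub>i V\<^sub>j\<^sup>*\<close> for the Gram matrix of the rows of \<open>V\<close>. The theorem says that the
  completely bounded norm of the homomorphism is governed by the duality between two cones of
  positive semidefinite matrices: Gram matrices of vectors \<open>V\<^sub>j\<close> on one side and of vectors
  \<open>b\<^sub>j\<close>, which come from matrix valued functions, on the other. The constant \<open>\<gamma>\<close> is exactly the
  best bound for this pairing.

  \<^emph>\<open>Contractivity.\<close> Linear functions of dual norm at most 1 show that a contractive homomorphism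
  has \<open>\<Sum>\<^sub>i\<^sub>j a\<^sub>i\<^sub>j x\<^sub>i \<cdot> cnj x\<^sub>j = \<parallel>\<Sum>\<^sub>j x\<^sub>j V\<^sub>j\<parallel>\<^sup>2 \<le> 1\<close> on the dual unit ball, that is, the Gram matrix
  has injective norm at most 1. The converse holds too (\<open>contractive_iff\<close>).

  \<^emph>\<open>Upper bound.\<close> Let \<open>F\<close> be matrix valued with norm at most 1, \<open>W = F 0\<close>, and let
  \<open>Y\<^sub>z = \<Sum>\<^sub>j z\<^sub>j Y\<^sub>j\<close> be its derivative at 0. The amplified homomorphism sends \<open>F\<close> to the block
  matrix with first row \<open>W, \<Sum>\<^sub>j V\<^sub>j \<otimes> Y\<^sub>j\<close> and second row \<open>0, I \<otimes> W\<close>. The Schwarz-Pick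
  inequality says that \<open>\<bar>\<langle>g, Y\<^sub>z h\<rangle>\<bar>\<^sup>2 \<le> (\<parallel>g\<parallel>\<^sup>2 - \<parallel>W\<^sup>* g\<parallel>\<^sup>2) (\<parallel>h\<parallel>\<^sup>2 - \<parallel>W h\<parallel>\<^sup>2)\<close> for \<open>z\<close> in the
  unit ball (\<open>matrix_schwarz_pick_ball\<close>). For fixed \<open>g\<close>, the functionals \<open>h \<mapsto> \<langle>g, Y\<^sub>j h\<rangle>\<close> are
  represented by vectors \<open>x\<^sub>j\<close> with respect to the form \<open>\<parallel>h\<parallel>\<^sup>2 - \<parallel>W h\<parallel>\<^sup>2\<close>, made definite by a
  small multiple of the identity, and the inequality says that the Gram matrix \<open>B\<close> of the \<open>x\<^sub>j\<close> has injective norm at most \<open>\<parallel>g\<parallel>\<^sup>2 - \<parallel>W\<^sup>* g\<parallel>\<^sup>2\<close>. The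
  upper right block is thereby controlled by \<open>\<Sum>\<^sub>i\<^sub>j a\<^sub>i\<^sub>j b\<^sub>i\<^sub>j\<close>, hence by \<open>\<gamma>\<close>
  (\<open>derivative_block_bound\<close>). The defects \<open>\<parallel>g\<parallel>\<^sup>2 - \<parallel>W\<^sup>* g\<parallel>\<^sup>2\<close> and \<open>\<parallel>h\<parallel>\<^sup>2 - \<parallel>W h\<parallel>\<^sup>2\<close> are just what the
  diagonal blocks leave free, and because \<open>\<gamma> \<ge> 1\<close> the whole block matrix has norm at most
  \<open>sqrt \<gamma>\<close> (\<open>block_operator_bound\<close>).

  \<^emph>\<open>Sharpness.\<close> In finite dimension the pairing attains the value \<open>\<gamma>\<close> at two matrices \<open>A\<close>, \<open>B\<close>
  of injective norm at most 1 (\<open>gamma_const_attained\<close>). Factor both as Gram matrices, of vectors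
  \<open>V\<^sub>j\<close> and \<open>b\<^sub>j\<close>. The homomorphism of \<open>V\<close> is contractive, and the linear function whose value at
  \<open>z\<close> has first row \<open>\<Sum>\<^sub>j z\<^sub>j b\<^sub>j\<close> and zeros elsewhere has norm at most 1; its image has a row of
  squared length \<open>\<Sum>\<^sub>i\<^sub>j a\<^sub>i\<^sub>j b\<^sub>i\<^sub>j = \<gamma>\<close> (\<open>pairing_le_cb_norm\<close>).
\<close>

section \<open>Vectors and matrices of size \<open>k\<close>\<close>

text \<open>
  The size of the matrices is a varying natural number, so vectors are functions on \<open>nat\<close> of
  which only the values below \<open>k\<close> count; this avoids carrier side conditions in the
  estimates.
\<close>
definition cinner :: "nat \<Rightarrow> (nat \<Rightarrow> complex) \<Rightarrow> (nat \<Rightarrow> complex) \<Rightarrow> complex" where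
  "cinner k u v = (\<Sum>i<k. cnj (u i) * v i)"

definition norm_sq :: "nat \<Rightarrow> (nat \<Rightarrow> complex) \<Rightarrow> real" where
  "norm_sq k u = (\<Sum>i<k. (cmod (u i))\<^sup>2)"

definition app_mat :: "nat \<Rightarrow> (nat \<Rightarrow> nat \<Rightarrow> complex) \<Rightarrow> (nat \<Rightarrow> complex) \<Rightarrow> nat \<Rightarrow> complex" where
  "app_mat k W h = (\<lambda>i. \<Sum>j<k. W i j * h j)"

definition conj_transp :: "(nat \<Rightarrow> nat \<Rightarrow> complex) \<Rightarrow> nat \<Rightarrow> nat \<Rightarrow> complex" where
  "conj_transp W = (\<lambda>i j. cnj (W j i))"

lemma cinner_self: "cinner k u u = of_real (norm_sq k u)"
  by (simp add: cinner_def norm_sq_def complex_norm_square mult.commute del: of_real_power)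

lemma norm_sq_nonneg [simp]: "0 \<le> norm_sq k u"
  by (simp add: norm_sq_def sum_nonneg)

lemma cinner_add_right: "cinner k u (\<lambda>i. v i + w i) = cinner k u v + cinner k u w"
  by (simp add: cinner_def ring_distribs sum.distrib)

lemma cinner_scale_right: "cinner k u (\<lambda>i. c * v i) = c * cinner k u v"
  by (simp add: cinner_def sum_distrib_left algebra_simps)

lemma cinner_add_left: "cinner k (\<lambda>i. v i + w i) u = cinner k v u + cinner k w u"
  by (simp add: cinner_def ring_distribs sum.distrib)

lemma cinner_scale_left: "cinner k (\<lambda>i. c * v i) u = cnj c * cinner k v u"
  by (simp add: cinner_def sum_distrib_left algebra_simps)

lemma cinner_cnj: "cnj (cinner k u v) = cinner k v u"
  by (simp add: cinner_def mult.commute)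

lemma norm_sq_cong: "(\<And>i. i < k \<Longrightarrow> u i = v i) \<Longrightarrow> norm_sq k u = norm_sq k v"
  by (simp add: norm_sq_def)

lemma norm_sq_scale: "norm_sq k (\<lambda>i. c * u i) = (cmod c)\<^sup>2 * norm_sq k u"
  by (simp add: norm_sq_def sum_distrib_left norm_mult power_mult_distrib)

lemma norm_sq_add: "norm_sq k (\<lambda>i. u i + v i) = norm_sq k u + norm_sq k v + 2 * Re (cinner k u v)"
proof -
  have "complex_of_real (norm_sq k (\<lambda>i. u i + v i))
      = of_real (norm_sq k u) + of_real (norm_sq k v) + (cinner k u v + cnj (cinner k u v))"
    by (simp add: cinner_self [symmetric] cinner_add_left cinner_add_right cinner_cnj)
  also have "\<dots> = complex_of_real (norm_sq k u + norm_sq k v + 2 * Re (cinner k u v))"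
    by (simp add: complex_add_cnj)
  finally show ?thesis
    using of_real_eq_iff by blast
qed

lemma cmod_cinner_le: "cmod (cinner k u v) \<le> sqrt (norm_sq k u) * sqrt (norm_sq k v)"
proof -
  have "cmod (cinner k u v) \<le> (\<Sum>i<k. \<bar>cmod (u i)\<bar> * \<bar>cmod (v i)\<bar>)"
    unfolding cinner_def by (rule order_trans [OF norm_sum]) (simp add: norm_mult)
  also have "\<dots> \<le> L2_set (\<lambda>i. cmod (u i)) {..<k} * L2_set (\<lambda>i. cmod (v i)) {..<k}"
    by (rule L2_set_mult_ineq)
  finally show ?thesis by (simp add: L2_set_def norm_sq_def)
qed

lemma Re_cinner_le: "2 * Re (cinner k u v) \<le> norm_sq k u + norm_sq k v"
proof -
  have "0 \<le> norm_sq k (\<lambda>i. u i + (-1) * v i)" by simp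
  also have "\<dots> = norm_sq k u + norm_sq k v - 2 * Re (cinner k u v)"
    unfolding norm_sq_add norm_sq_scale cinner_scale_right by simp
  finally show ?thesis by simp
qed

lemma cinner_app_mat_conj_transp: "cinner k u (app_mat k W v) = cinner k (app_mat k (conj_transp W) u) v"
proof -
  have "cinner k u (app_mat k W v) = (\<Sum>i<k. \<Sum>j<k. cnj (u i) * W i j * v j)"
    by (simp add: cinner_def app_mat_def sum_distrib_left algebra_simps)
  also have "\<dots> = (\<Sum>j<k. \<Sum>i<k. cnj (u i) * W i j * v j)"
    by (rule sum.swap)
  also have "\<dots> = cinner k (app_mat k (conj_transp W) u) v"
    by (simp add: cinner_def app_mat_def conj_transp_def sum_distrib_right mult.commute [of "W _ _"])
  finally show ?thesis .
qed

lemma app_mat_add: "app_mat k W (\<lambda>i. u i + v i) = (\<lambda>i. app_mat k W u i + app_mat k W v i)"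
  by (simp add: app_mat_def ring_distribs sum.distrib)

lemma app_mat_scale: "app_mat k W (\<lambda>i. c * v i) = (\<lambda>i. c * app_mat k W v i)"
  by (simp add: app_mat_def sum_distrib_left algebra_simps)

lemma conj_transp_conj_transp [simp]: "conj_transp (conj_transp W) = W"
  by (simp add: conj_transp_def)

text \<open>
  The adjoint of a contraction is a contraction: apply the arithmetic-geometric
  inequality to \<open>\<langle>g, W W\<^sup>* g\<rangle> = \<parallel>W\<^sup>* g\<parallel>\<^sup>2\<close>.
\<close>
lemma norm_sq_conj_transp_le:
  assumes "\<And>h. norm_sq k (app_mat k W h) \<le> norm_sq k h"
  shows "norm_sq k (app_mat k (conj_transp W) g) \<le> norm_sq k g"
proof -
  have "complex_of_real (norm_sq k (app_mat k (conj_transp W) g)) = cinner k g (app_mat k W (app_mat k (conj_transp W) g))"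
    by (simp add: cinner_app_mat_conj_transp cinner_self)
  then have "2 * norm_sq k (app_mat k (conj_transp W) g) = 2 * Re (cinner k g (app_mat k W (app_mat k (conj_transp W) g)))"
    by (metis Re_complex_of_real)
  also have "\<dots> \<le> norm_sq k g + norm_sq k (app_mat k W (app_mat k (conj_transp W) g))"
    by (rule Re_cinner_le)
  also have "\<dots> \<le> norm_sq k g + norm_sq k (app_mat k (conj_transp W) g)"
    using assms by simp
  finally show ?thesis by simp
qed

section \<open>From additive to multiplicative bounds\<close>

text \<open>
  Optimising \<open>t\<^sup>2 a + b / t\<^sup>2\<close> over \<open>t\<close> gives \<open>2 (sqrt a) (sqrt b)\<close>; when \<open>a\<close> or \<open>b\<close> vanishes the
  optimum is a limit, so both square roots are enlarged by a small \<open>d\<close> first.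
\<close>
lemma additive_to_geometric_bound:
  fixes a b y :: real
  assumes a: "0 \<le> a" and b: "0 \<le> b" and y: "\<And>t. t > 0 \<Longrightarrow> 2 * y \<le> t\<^sup>2 * a + b / t\<^sup>2"
  shows "y \<le> sqrt a * sqrt b"
proof -
  have "((\<lambda>d. ((sqrt a + d) * (sqrt b + d))) \<longlongrightarrow> (sqrt a + 0) * (sqrt b + 0)) (at_right 0)"
    by (intro tendsto_intros)
  moreover have "\<forall>\<^sub>F d in at_right 0. y \<le> (sqrt a + d) * (sqrt b + d)"
  proof (rule eventually_at_right_less [THEN eventually_mono])
    fix d :: real assume d: "0 < d"
    define u v where "u = sqrt a + d" and "v = sqrt b + d"
    have uv: "u > 0" "v > 0" using d a b by (auto simp: u_def v_def add_nonneg_pos)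
    have au: "a \<le> u\<^sup>2" "b \<le> v\<^sup>2"
      using a b d by (auto simp: u_def v_def intro!: sqrt_le_D[OF less_imp_le] )
    have "2 * y \<le> (sqrt (v / u))\<^sup>2 * a + b / (sqrt (v / u))\<^sup>2"
      using uv by (intro y) simp
    also have "\<dots> = (v / u) * a + b * (u / v)"
      using uv by simp
    also have "\<dots> \<le> (v / u) * u\<^sup>2 + v\<^sup>2 * (u / v)"
      using uv au by (intro add_mono mult_left_mono mult_right_mono) auto
    also have "\<dots> = 2 * (u * v)"
      using uv by (simp add: power2_eq_square)
    finally show "y \<le> (sqrt a + d) * (sqrt b + d)" by (simp add: u_def v_def)
  qed
  ultimately have "y \<le> (sqrt a + 0) * (sqrt b + 0)"
    by (rule tendsto_lowerbound) simp
  then show ?thesis by simp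
qed

text \<open>
  A sesquilinear form that satisfies an arithmetic mean bound satisfies the geometric mean
  bound: scale \<open>u\<close> by \<open>t\<close>, \<open>v\<close> by \<open>1 / t\<close>, and rotate \<open>v\<close> to make the form real. It serves
  both as the Cauchy-Schwarz inequality for semi-inner products and to put the Schwarz-Pick
  inequality in its product form.
\<close>
lemma sesquilinear_bound:
  fixes S :: "(nat \<Rightarrow> complex) \<Rightarrow> (nat \<Rightarrow> complex) \<Rightarrow> complex"
  assumes S: "\<And>c u v. S (\<lambda>i. c * u i) v = cnj c * S u v" "\<And>c u v. S u (\<lambda>i. c * v i) = c * S u v"
    and P: "\<And>c u. P (\<lambda>i. c * u i) = (cmod c)\<^sup>2 * P u" "\<And>u. 0 \<le> P u"
    and Q: "\<And>c u. Q (\<lambda>i. c * u i) = (cmod c)\<^sup>2 * Q u" "\<And>u. 0 \<le> Q u"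
    and le: "\<And>u v. 2 * Re (S u v) \<le> P u + Q v"
  shows "cmod (S u v) \<le> sqrt (P u) * sqrt (Q v)"
proof (rule additive_to_geometric_bound [OF P(2) Q(2)])
  fix t :: real assume t: "0 < t"
  define w where "w = (if S u v = 0 then 1 else cnj (S u v) / of_real (cmod (S u v)))"
  have w1: "cmod w = 1" by (simp add: w_def norm_divide)
  have wS: "w * S u v = of_real (cmod (S u v))"
  proof (cases "S u v = 0")
    case False
    then have "w * S u v = (S u v * cnj (S u v)) / of_real (cmod (S u v))"
      by (simp add: w_def)
    also have "\<dots> = of_real (cmod (S u v) * cmod (S u v)) / of_real (cmod (S u v))"
      by (simp only: complex_norm_square [symmetric] power2_eq_square of_real_mult)
    finally show ?thesis using False by simp
  qed simp
  have "2 * Re (S (\<lambda>i. of_real t * u i) (\<lambda>i. (w / of_real t) * v i))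
      \<le> (cmod (of_real t))\<^sup>2 * P u + (cmod (w / of_real t))\<^sup>2 * Q v"
    unfolding P(1) [symmetric] Q(1) [symmetric] by (rule le)
  also have "S (\<lambda>i. of_real t * u i) (\<lambda>i. (w / of_real t) * v i) = w * S u v"
    unfolding S using t by simp
  finally show "2 * cmod (S u v) \<le> t\<^sup>2 * P u + Q v / t\<^sup>2"
    using t by (simp add: wS norm_divide w1 power_divide)
qed

lemma le_of_square_le_mult:
  fixes r b :: real
  assumes "r * r \<le> b * r" "0 \<le> r" "0 \<le> b"
  shows "r \<le> b"
  using assms by (cases "r = 0") (auto simp: mult_le_cancel_right)

lemma cauchy_schwarz_pair:
  assumes "0 \<le> a" "0 \<le> b" "0 \<le> s" "0 \<le> t"
  shows "sqrt s * sqrt a + sqrt t * sqrt b \<le> sqrt (s + t) * sqrt (a + b)"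
proof -
  have "(sqrt s * sqrt a + sqrt t * sqrt b)\<^sup>2 + (sqrt s * sqrt b - sqrt t * sqrt a)\<^sup>2
      = ((sqrt s)\<^sup>2 + (sqrt t)\<^sup>2) * ((sqrt a)\<^sup>2 + (sqrt b)\<^sup>2)"
    by (simp add: power2_eq_square algebra_simps)
  also have "\<dots> = (s + t) * (a + b)" using assms by simp
  finally have "(sqrt s * sqrt a + sqrt t * sqrt b)\<^sup>2 \<le> (s + t) * (a + b)"
    using zero_le_power2 [of "sqrt s * sqrt b - sqrt t * sqrt a"] by linarith
  then show ?thesis by (simp add: real_le_rsqrt flip: real_sqrt_mult)
qed

section \<open>The Schwarz-Pick inequality on the disc\<close>

text \<open>
  The additive form of the Schwarz-Pick inequality. With \<open>W = G 0\<close>, \<open>a = W\<^sup>* g\<close>,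
  \<open>b = W h\<close>, the function \<open>\<Psi> t = (g\<^sup>* + t b\<^sup>*) (G t) (h + t a)\<close> has
  \<open>\<Psi>' 0 = \<langle>g, Y h\<rangle> + \<parallel>a\<parallel>\<^sup>2 + \<parallel>b\<parallel>\<^sup>2\<close>. On the unit circle \<open>\<Psi> t / t = \<langle>b + t g, (G t) (h + t a)\<rangle>\<close>, whose
  real part is at most \<open>(\<parallel>b + t g\<parallel>\<^sup>2 + \<parallel>h + t a\<parallel>\<^sup>2) / 2\<close> because \<open>G t\<close> is a contraction. Averaged over the
  circle, the cross terms of the right hand side disappear and the left hand side becomes
  \<open>\<Psi>' 0\<close>. The average is taken by the maximum principle for a real part.
\<close>
lemma matrix_schwarz_pick_disc:
  assumes R: "1 < R"
    and hol: "\<And>p q. p < k \<Longrightarrow> q < k \<Longrightarrow> (\<lambda>t. G t p q) holomorphic_on ball 0 R"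
    and der: "\<And>p q. p < k \<Longrightarrow> q < k \<Longrightarrow> ((\<lambda>t. G t p q) has_field_derivative Y p q) (at 0)"
    and con: "\<And>t h. cmod t \<le> 1 \<Longrightarrow> norm_sq k (app_mat k (G t) h) \<le> norm_sq k h"
  shows "2 * Re (cinner k g (app_mat k Y h))
      \<le> (norm_sq k g - norm_sq k (app_mat k (conj_transp (G 0)) g)) + (norm_sq k h - norm_sq k (app_mat k (G 0) h))"
proof -
  define a where "a = app_mat k (conj_transp (G 0)) g"
  define b where "b = app_mat k (G 0) h"
  define \<Psi> where "\<Psi> t = (\<Sum>p<k. \<Sum>q<k. (cnj (g p) + t * cnj (b p)) * (G t p q * (h q + t * a q)))" for t
  have holP: "\<Psi> holomorphic_on ball 0 R"
    unfolding \<Psi>_def by (intro holomorphic_intros hol) auto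
  have derP: "(\<Psi> has_field_derivative
      (\<Sum>p<k. \<Sum>q<k. cnj (b p) * (G 0 p q * h q) + cnj (g p) * (Y p q * h q + G 0 p q * a q))) (at 0)"
    unfolding \<Psi>_def
  proof (intro DERIV_sum)
    fix p q assume "p \<in> {..<k}" "q \<in> {..<k}"
    then have D: "((\<lambda>t. G t p q) has_field_derivative Y p q) (at 0)"
      using der by simp
    show "((\<lambda>t. (cnj (g p) + t * cnj (b p)) * (G t p q * (h q + t * a q))) has_field_derivative
        cnj (b p) * (G 0 p q * h q) + cnj (g p) * (Y p q * h q + G 0 p q * a q)) (at 0)"
      by (auto intro!: derivative_eq_intros D simp: algebra_simps)
  qed
  have "(\<Sum>p<k. \<Sum>q<k. cnj (b p) * (G 0 p q * h q) + cnj (g p) * (Y p q * h q + G 0 p q * a q))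
      = cinner k b (app_mat k (G 0) h) + (cinner k g (app_mat k Y h) + cinner k g (app_mat k (G 0) a))"
    by (simp add: cinner_def app_mat_def sum.distrib ring_distribs sum_distrib_left)
  also have "\<dots> = of_real (norm_sq k b) + cinner k g (app_mat k Y h) + of_real (norm_sq k a)"
    by (simp add: b_def [symmetric] cinner_self cinner_app_mat_conj_transp [of k g "G 0"] a_def [symmetric])
  finally have dP: "deriv \<Psi> 0 = of_real (norm_sq k b) + cinner k g (app_mat k Y h) + of_real (norm_sq k a)"
    using derP DERIV_imp_deriv by metis
  (* (\<Psi> t - \<Psi> 0) / t extended over 0, corrected by a linear term: on the circle the real part
     of cnj (\<Psi> 0) * t cancels that of \<Psi> 0 / t, and the other two products cancel the cross
     terms of the squared norms. *)
  define H where "H t = (if t = 0 then deriv \<Psi> 0 else (\<Psi> t - \<Psi> 0) / (t - 0))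
      + (cnj (\<Psi> 0) - cinner k b g - cinner k h a) * t" for t
  have holH: "H holomorphic_on ball 0 R"
    unfolding H_def using R by (intro holomorphic_intros pole_lemma holP) auto
  have sub: "cball 0 1 \<subseteq> ball (0::complex) R" using R by auto
  have "Re (H 0) \<le> (norm_sq k g + norm_sq k b + norm_sq k h + norm_sq k a) / 2"
  proof (rule maximum_real_frontier [where S = "cball 0 1" and f = H and \<xi> = 0])
    show "H holomorphic_on interior (cball 0 1)"
      using holH by (rule holomorphic_on_subset) (use sub in auto)
    show "continuous_on (closure (cball 0 1)) H"
      using holH sub holomorphic_on_imp_continuous_on holomorphic_on_subset by auto
    fix t :: complex assume "t \<in> frontier (cball 0 1)"
    then have t1: "cmod t = 1" by (simp add: frontier_def)
    then have t0: "t \<noteq> 0" by auto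
    have tt: "t * cnj t = 1"
      using t1 by (simp add: complex_norm_square [symmetric])
    have "1 / t = cnj t" using tt t0 by (simp add: divide_eq_eq mult.commute)
    then have inv: "x / t = x * cnj t" for x
      by (metis mult.right_neutral times_divide_eq_right)
    have "\<Psi> t * cnj t = cinner k (\<lambda>i. b i + t * g i) (app_mat k (G t) (\<lambda>i. h i + t * a i))"
    proof -
      have "(cnj (g p) + t * cnj (b p)) * cnj t = cnj (b p + t * g p)" for p
        using tt by (simp add: algebra_simps mult.assoc [symmetric])
      then have *: "(cnj (g p) + t * cnj (b p)) * x * cnj t = cnj (b p + t * g p) * x" for p x
        by (metis mult.assoc mult.commute)
      show ?thesis
        unfolding \<Psi>_def cinner_def app_mat_def sum_distrib_right sum_distrib_left *
        by simp
    qed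
    then have "2 * Re (\<Psi> t * cnj t)
        \<le> norm_sq k (\<lambda>i. b i + t * g i) + norm_sq k (app_mat k (G t) (\<lambda>i. h i + t * a i))"
      using Re_cinner_le by simp
    also have "\<dots> \<le> norm_sq k (\<lambda>i. b i + t * g i) + norm_sq k (\<lambda>i. h i + t * a i)"
      using con [of t] t1 by simp
    also have "\<dots> = norm_sq k g + norm_sq k b + norm_sq k h + norm_sq k a
        + 2 * Re (t * cinner k b g) + 2 * Re (t * cinner k h a)"
      unfolding norm_sq_add norm_sq_scale cinner_scale_right t1 by simp
    finally have 1: "2 * Re (\<Psi> t * cnj t) \<le> norm_sq k g + norm_sq k b + norm_sq k h + norm_sq k a
        + 2 * Re (t * cinner k b g) + 2 * Re (t * cinner k h a)" .
    have 2: "H t = \<Psi> t * cnj t - \<Psi> 0 * cnj t + cnj (\<Psi> 0 * cnj t) - t * cinner k b g - t * cinner k h a"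
      using t0 by (simp add: H_def inv algebra_simps)
    have "Re (H t) = Re (\<Psi> t * cnj t) - Re (t * cinner k b g) - Re (t * cinner k h a)"
      unfolding 2 by simp
    with 1 show "Re (H t) \<le> (norm_sq k g + norm_sq k b + norm_sq k h + norm_sq k a) / 2"
      by simp
  qed auto
  then show ?thesis
    by (simp add: H_def dP a_def b_def)
qed

section \<open>Riesz representation in the defect form\<close>

text \<open>
  A definite matrix has trivial kernel, hence is invertible.
\<close>
lemma positive_definite_solve:
  assumes pd: "\<And>h. (\<exists>i<k. h i \<noteq> 0) \<Longrightarrow> cinner k h (app_mat k P h) \<noteq> 0"
  obtains x where "\<And>i. i < k \<Longrightarrow> app_mat k P x i = w i"
proof -
  define M where "M = Matrix.mat k k (\<lambda>(i, j). P i j)"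
  have M: "M \<in> carrier_mat k k" by (simp add: M_def)
  have mv: "vec_index (M *\<^sub>v v) i = app_mat k P (vec_index v) i" if "v \<in> carrier_vec k" "i < k" for v i
    using that by (auto simp: M_def app_mat_def scalar_prod_def atLeast0LessThan intro!: sum.cong)
  have "det M \<noteq> 0"
  proof
    assume "det M = 0"
    then obtain v where v: "v \<in> carrier_vec k" "v \<noteq> 0\<^sub>v k" "M *\<^sub>v v = 0\<^sub>v k"
      using det_0_iff_vec_prod_zero_field [OF M] by auto
    then have "\<exists>i<k. vec_index v i \<noteq> 0"
      by (metis carrier_vecD eq_vecI index_zero_vec)
    moreover have "cinner k (vec_index v) (app_mat k P (vec_index v)) = 0"
      using mv [OF v(1)] v(3) by (simp add: cinner_def)
    ultimately show False using pd by blast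
  qed
  then have "M \<in> Units (ring_mat TYPE(complex) k ())"
    by (rule det_non_zero_imp_unit [OF M])
  then obtain Q where Q: "Q \<in> carrier_mat k k" "M * Q = 1\<^sub>m k"
    by (auto simp: Units_def ring_mat_simps)
  define v where "v = Q *\<^sub>v Matrix.vec k w"
  have v: "v \<in> carrier_vec k" using Q by (simp add: v_def)
  have "M *\<^sub>v v = Matrix.vec k w"
    unfolding v_def using M Q by (simp add: assoc_mult_mat_vec [symmetric])
  with mv [OF v] show ?thesis
    by (intro that [of "vec_index v"]) (metis index_vec)
qed

definition defect :: "nat \<Rightarrow> (nat \<Rightarrow> nat \<Rightarrow> complex) \<Rightarrow> (nat \<Rightarrow> complex) \<Rightarrow> real" where
  "defect k W h = norm_sq k h - norm_sq k (app_mat k W h)"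

lemma defect_scale: "defect k W (\<lambda>i. c * h i) = (cmod c)\<^sup>2 * defect k W h"
  by (simp add: defect_def app_mat_scale norm_sq_scale right_diff_distrib)

text \<open>
  The defect form itself may be degenerate. Adding \<open>e\<close> times the identity makes it definite, so
  that every linear functional is represented by a vector.
\<close>
lemma regularised_defect_riesz:
  assumes con: "\<And>h. norm_sq k (app_mat k W h) \<le> norm_sq k h" and e: "0 < e"
  defines "P \<equiv> (\<lambda>i j. (if i = j then 1 + of_real e else 0) - (\<Sum>l<k. cnj (W l i) * W l j))"
  shows "\<And>u v. cinner k u (app_mat k P v) = (1 + of_real e) * cinner k u v - cinner k (app_mat k W u) (app_mat k W v)"
    and "\<exists>x. \<forall>h. (\<Sum>i<k. y i * h i) = cinner k x (app_mat k P h)"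
proof -
  have apP: "app_mat k P v i = (1 + of_real e) * v i - app_mat k (conj_transp W) (app_mat k W v) i" if "i < k" for v i
  proof -
    have "app_mat k P v i = (\<Sum>j<k. (if i = j then (1 + of_real e) * v j else 0))
        - (\<Sum>j<k. \<Sum>l<k. cnj (W l i) * W l j * v j)"
    proof -
      have "P i j * v j = (if i = j then (1 + of_real e) * v j else 0)
          - (\<Sum>l<k. cnj (W l i) * W l j * v j)" for j
        by (simp add: P_def left_diff_distrib sum_distrib_right)
      then show ?thesis by (simp add: app_mat_def sum_subtractf)
    qed
    also have "(\<Sum>j<k. \<Sum>l<k. cnj (W l i) * W l j * v j) = (\<Sum>l<k. \<Sum>j<k. cnj (W l i) * W l j * v j)"
      by (rule sum.swap)
    also have "\<dots> = app_mat k (conj_transp W) (app_mat k W v) i"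
      by (simp add: app_mat_def conj_transp_def sum_distrib_left mult.assoc)
    finally show ?thesis using that by simp
  qed
  show form: "cinner k u (app_mat k P v) = (1 + of_real e) * cinner k u v - cinner k (app_mat k W u) (app_mat k W v)" for u v
  proof -
    have "cinner k u (app_mat k P v) = cinner k u (\<lambda>i. (1 + of_real e) * v i + (-1) * app_mat k (conj_transp W) (app_mat k W v) i)"
      using apP by (simp add: cinner_def)
    also have "\<dots> = (1 + of_real e) * cinner k u v - cinner k (app_mat k W u) (app_mat k W v)"
      unfolding cinner_add_right cinner_scale_right by (simp add: cinner_app_mat_conj_transp)
    finally show ?thesis .
  qed
  have pd: "cinner k h (app_mat k P h) \<noteq> 0" if "\<exists>i<k. h i \<noteq> 0" for h
  proof -
    from that obtain i where i: "i < k" "h i \<noteq> 0" by blast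
    have "0 < norm_sq k h"
      unfolding norm_sq_def using i by (intro sum_pos2 [of _ i]) auto
    then have "0 < e * norm_sq k h + (norm_sq k h - norm_sq k (app_mat k W h))"
      using con [of h] e by (simp add: add_pos_nonneg)
    moreover have "cinner k h (app_mat k P h) = of_real (e * norm_sq k h + (norm_sq k h - norm_sq k (app_mat k W h)))"
      by (simp add: form cinner_self algebra_simps)
    ultimately show ?thesis by (metis less_irrefl of_real_eq_0_iff)
  qed
  obtain x where x: "\<And>i. i < k \<Longrightarrow> app_mat k P x i = cnj (y i)"
    using positive_definite_solve [of k P "\<lambda>i. cnj (y i)"] pd by blast
  have "(\<Sum>i<k. y i * h i) = cinner k x (app_mat k P h)" for h
  proof -
    have "(\<Sum>i<k. y i * h i) = cinner k (app_mat k P x) h"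
      using x by (simp add: cinner_def)
    also have "\<dots> = cnj (cinner k h (app_mat k P x))" by (simp add: cinner_cnj)
    also have "\<dots> = cinner k x (app_mat k P h)" by (simp add: form cinner_cnj)
    finally show ?thesis .
  qed
  then show "\<exists>x. \<forall>h. (\<Sum>i<k. y i * h i) = cinner k x (app_mat k P h)" by blast
qed

lemma cinner_sum_left: "cinner k (\<lambda>p. \<Sum>j\<in>J. c j * u j p) v = (\<Sum>j\<in>J. cnj (c j) * cinner k (u j) v)"
  unfolding cinner_def cnj_sum sum_distrib_right sum_distrib_left
  by (subst sum.swap) (simp add: mult.assoc)

lemma cinner_sum_right: "cinner k v (\<lambda>p. \<Sum>j\<in>J. c j * u j p) = (\<Sum>j\<in>J. c j * cinner k v (u j))"
  unfolding cinner_def sum_distrib_left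
  by (subst sum.swap) (simp add: algebra_simps)

lemma app_mat_sum: "app_mat k W (\<lambda>p. \<Sum>j\<in>J. c j * u j p) = (\<lambda>p. \<Sum>j\<in>J. c j * app_mat k W (u j) p)"
  unfolding app_mat_def sum_distrib_left
  by (subst sum.swap) (simp add: algebra_simps)

lemma app_mat_sum_matrix: "app_mat k (\<lambda>p q. \<Sum>j\<in>J. c j * Y j p q) h = (\<lambda>p. \<Sum>j\<in>J. c j * app_mat k (Y j) h p)"
  unfolding app_mat_def sum_distrib_right sum_distrib_left
  by (subst sum.swap) (simp add: mult.assoc)

lemma defect_nonneg: "(\<And>h. norm_sq k (app_mat k W h) \<le> norm_sq k h) \<Longrightarrow> 0 \<le> defect k W h"
  by (simp add: defect_def)

section \<open>Bounds for the block operator\<close>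

text \<open>
  The heart of the upper bound; \<open>c\<close> will be \<open>\<gamma>\<close>. For fixed \<open>g\<close>, the functionals
  \<open>h \<mapsto> \<langle>g, Y\<^sub>j h\<rangle>\<close> are represented by vectors \<open>x\<^sub>j\<close> in the semi-inner product \<open>S\<close> given by
  the regularised defect form of \<open>W\<close>. By the Schwarz-Pick bound, the Gram matrix \<open>B\<close> of the \<open>x\<^sub>j\<close> has injective
  norm at most \<open>d\<^sup>2\<close>, the defect of \<open>g\<close> with respect to \<open>W\<^sup>*\<close>. The sum to be estimated is \<open>\<Sum>\<^sub>l S (X\<^sub>l) (h\<^sub>l)\<close> with
  \<open>\<Sum>\<^sub>l S (X\<^sub>l) (X\<^sub>l)\<close> equal to the pairing of \<open>B\<close> with the Gram matrix of \<open>V\<close>, so that the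
  Cauchy-Schwarz inequality concludes. Finally the regularisation \<open>e\<close> tends to 0.
\<close>
lemma derivative_block_bound:
  fixes V :: "'m::finite \<Rightarrow> nat \<Rightarrow> complex" and N :: "complex ^ 'm \<Rightarrow> real"
    and Y :: "'m \<Rightarrow> nat \<Rightarrow> nat \<Rightarrow> complex"
  assumes N0: "N 0 = 0"
    and con: "\<And>h. norm_sq k (app_mat k W h) \<le> norm_sq k h"
    and pick: "\<And>z g h. N z \<le> 1 \<Longrightarrow> 2 * Re (cinner k g (app_mat k (\<lambda>p q. \<Sum>j\<in>UNIV. z $ j * Y j p q) h))
        \<le> defect k (conj_transp W) g + defect k W h"
    and adm: "\<And>B. psd B \<Longrightarrow>
        Re (\<Sum>i\<in>UNIV. \<Sum>j\<in>UNIV. (\<Sum>l<n. V i l * cnj (V j l)) * B $ i $ j) \<le> c * sesq_sup N B"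
    and c: "0 \<le> c"
  shows "Re (\<Sum>l<n. cinner k g (\<lambda>p. \<Sum>j\<in>UNIV. V j l * app_mat k (Y j) (h l) p))
      \<le> sqrt c * sqrt (defect k (conj_transp W) g) * sqrt (\<Sum>l<n. defect k W (h l))"
    (is "Re ?X \<le> _")
proof -
  define d where "d = sqrt (defect k (conj_transp W) g)"
  have Dn: "0 \<le> defect k W h" "0 \<le> defect k (conj_transp W) h" for h
    using con norm_sq_conj_transp_le [of k W] by (auto intro!: defect_nonneg)
  have d0: "0 \<le> d" by (simp add: d_def Dn)
  have form_bound: "cmod (cinner k g (app_mat k (\<lambda>p q. \<Sum>j\<in>UNIV. z $ j * Y j p q) h))
      \<le> d * sqrt (defect k W h)" if "N z \<le> 1" for z h
    unfolding d_def
    by (rule sesquilinear_bound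
        [where S = "\<lambda>g h. cinner k g (app_mat k (\<lambda>p q. \<Sum>j\<in>UNIV. z $ j * Y j p q) h)"])
      (use that in \<open>auto simp: cinner_scale_left app_mat_scale cinner_scale_right defect_scale Dn pick\<close>)
  have eps: "Re ?X \<le> sqrt c * d * sqrt (\<Sum>l<n. e * norm_sq k (h l) + defect k W (h l))"
    if e: "0 < e" for e
  proof -
    define P where "P \<equiv> (\<lambda>i j. (if i = j then 1 + of_real e else 0) - (\<Sum>l<k. cnj (W l i) * W l j))"
    define S where "S u v = cinner k u (app_mat k P v)" for u v
    define q where "q h = e * norm_sq k h + defect k W h" for h
    have S_eq: "S u v = (1 + of_real e) * cinner k u v - cinner k (app_mat k W u) (app_mat k W v)" for u v
      unfolding S_def P_def by (rule regularised_defect_riesz(1) [OF con e])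
    have S_self: "S u u = of_real (q u)" for u
      by (simp add: S_eq cinner_self q_def defect_def algebra_simps)
    have S_cnj: "cnj (S u v) = S v u" for u v
      by (simp add: S_eq cinner_cnj)
    have q0: "0 \<le> q u" for u
      using e by (simp add: q_def Dn)
    have q_scale: "q (\<lambda>i. a * u i) = (cmod a)\<^sup>2 * q u" for a u
      by (simp add: q_def norm_sq_scale defect_scale algebra_simps)
    have S_sum_left: "S (\<lambda>p. \<Sum>j\<in>J. a j * u j p) v = (\<Sum>j\<in>J. cnj (a j) * S (u j) v)"
      for J :: "'m set" and a u v
      by (simp add: S_def cinner_sum_left)
    have S_sum_right: "S v (\<lambda>p. \<Sum>j\<in>J. a j * u j p) = (\<Sum>j\<in>J. a j * S v (u j))"
      for J :: "'m set" and a u v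
      by (simp add: S_def app_mat_sum cinner_sum_right)
    have S_cs: "cmod (S u v) \<le> sqrt (q u) * sqrt (q v)" for u v
    proof (rule sesquilinear_bound [where S = S])
      fix u v
      have "of_real (q (\<lambda>i. u i + (-1) * v i)) = S u u + S v v - (S u v + cnj (S u v))"
        unfolding S_self [symmetric] S_cnj
        unfolding S_def app_mat_add app_mat_scale cinner_add_left cinner_add_right cinner_scale_left cinner_scale_right
        by (simp add: algebra_simps)
      also have "\<dots> = of_real (q u + q v - 2 * Re (S u v))"
        by (simp add: S_self complex_add_cnj)
      finally have "q (\<lambda>i. u i + (-1) * v i) = q u + q v - 2 * Re (S u v)"
        using of_real_eq_iff by blast
      with q0 [of "\<lambda>i. u i + (-1) * v i"] show "2 * Re (S u v) \<le> q u + q v" by simp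
    qed (auto simp: q0 q_scale S_def cinner_scale_left app_mat_scale cinner_scale_right)
    have "\<exists>x. \<forall>h. cinner k g (app_mat k (Y j) h) = S x h" for j
    proof -
      have "\<exists>x. \<forall>h. (\<Sum>i<k. (\<Sum>p<k. cnj (g p) * Y j p i) * h i) = S x h"
        unfolding S_def P_def by (rule regularised_defect_riesz(2) [OF con e])
      moreover have "(\<Sum>i<k. (\<Sum>p<k. cnj (g p) * Y j p i) * h i) = cinner k g (app_mat k (Y j) h)" for h
        unfolding cinner_def app_mat_def sum_distrib_left sum_distrib_right
        by (subst sum.swap) (simp add: mult.assoc)
      ultimately show ?thesis by simp
    qed
    then obtain x where x: "\<And>j h. cinner k g (app_mat k (Y j) h) = S (x j) h" by metis
    define xs where "xs a = (\<lambda>p. \<Sum>j\<in>UNIV. cnj (a j) * x j p)" for a :: "'m \<Rightarrow> complex"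
    have S_xs: "S (xs a) (xs b) = (\<Sum>i\<in>UNIV. \<Sum>j\<in>UNIV. a i * cnj (b j) * S (x i) (x j))" for a b
      unfolding xs_def S_sum_left S_sum_right by (simp add: sum_distrib_left mult.assoc)
    have S_xs_h: "S (xs a) h = (\<Sum>j\<in>UNIV. a j * cinner k g (app_mat k (Y j) h))" for a h
      unfolding xs_def S_sum_left by (simp add: x)
    define B :: "complex ^ 'm ^ 'm" where "B = (\<chi> i j. S (x i) (x j))"
    have "psd B"
      unfolding psd_def
    proof (intro conjI allI)
      show "B $ i $ j = cnj (B $ j $ i)" for i j
        by (simp add: B_def S_cnj)
      fix y :: "complex ^ 'm"
      have "(\<Sum>i\<in>UNIV. \<Sum>j\<in>UNIV. cnj (y $ i) * B $ i $ j * y $ j)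
          = S (xs (\<lambda>i. cnj (y $ i))) (xs (\<lambda>i. cnj (y $ i)))"
        unfolding S_xs by (simp add: B_def algebra_simps)
      then show "0 \<le> Re (\<Sum>i\<in>UNIV. \<Sum>j\<in>UNIV. cnj (y $ i) * B $ i $ j * y $ j)"
        by (simp add: S_self q0)
    qed
    (* the functional of z evaluated at its own representing vector *)
    have q_xs: "sqrt (q (xs (($) z))) \<le> d" if z: "N z \<le> 1" for z
    proof -
      define u where "u = xs (($) z)"
      have "q u = cmod (S u u)" by (simp add: S_self q0)
      also have "S u u = cinner k g (app_mat k (\<lambda>p q. \<Sum>j\<in>UNIV. z $ j * Y j p q) u)"
        unfolding app_mat_sum_matrix cinner_sum_right by (subst u_def) (simp add: S_xs_h)
      also have "cmod \<dots> \<le> d * sqrt (defect k W u)" by (rule form_bound [OF z])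
      also have "\<dots> \<le> d * sqrt (q u)"
        using e d0 by (intro mult_left_mono) (auto simp: q_def)
      finally have "sqrt (q u) * sqrt (q u) \<le> d * sqrt (q u)" by (simp add: q0)
      then show ?thesis
        unfolding u_def by (rule le_of_square_le_mult) (simp_all add: q0 d0)
    qed
    have "sesq_sup N B \<le> d\<^sup>2"
      unfolding sesq_sup_def
    proof (rule cSUP_least)
      show "{x. N x \<le> 1} \<times> {y. N y \<le> 1} \<noteq> {}" using N0 by (auto intro!: exI [of _ 0])
      fix zw assume "zw \<in> {x. N x \<le> 1} \<times> {y. N y \<le> 1}"
      then obtain z w where zw: "zw = (z, w)" "N z \<le> 1" "N w \<le> 1" by auto
      have "cmod (\<Sum>i\<in>UNIV. \<Sum>j\<in>UNIV. B $ i $ j * z $ i * cnj (w $ j)) = cmod (S (xs (($) z)) (xs (($) w)))"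
        unfolding S_xs by (simp add: B_def algebra_simps)
      also have "\<dots> \<le> sqrt (q (xs (($) z))) * sqrt (q (xs (($) w)))" by (rule S_cs)
      also have "\<dots> \<le> d * d" using zw d0 by (intro mult_mono q_xs) (auto simp: q0)
      finally show "(case zw of (x, y) \<Rightarrow> cmod (\<Sum>i\<in>UNIV. \<Sum>j\<in>UNIV. B $ i $ j * x $ i * cnj (y $ j))) \<le> d\<^sup>2"
        by (simp add: zw power2_eq_square)
    qed
    then have Bd: "c * sesq_sup N B \<le> c * d\<^sup>2" using c by (intro mult_left_mono)
    define X where "X l = xs (\<lambda>j. V j l)" for l
    have "complex_of_real (\<Sum>l<n. q (X l))
        = (\<Sum>l<n. \<Sum>i\<in>UNIV. \<Sum>j\<in>UNIV. V i l * cnj (V j l) * S (x i) (x j))"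
      by (simp add: S_self [symmetric] X_def S_xs)
    also have "\<dots> = (\<Sum>i\<in>UNIV. \<Sum>j\<in>UNIV. (\<Sum>l<n. V i l * cnj (V j l)) * B $ i $ j)"
      unfolding B_def sum_distrib_right
      by (subst sum.swap, rule sum.cong [OF refl], subst sum.swap) simp
    finally have "Re (complex_of_real (\<Sum>l<n. q (X l)))
        = Re (\<Sum>i\<in>UNIV. \<Sum>j\<in>UNIV. (\<Sum>l<n. V i l * cnj (V j l)) * B $ i $ j)"
      by (rule arg_cong)
    then have "(\<Sum>l<n. q (X l)) = Re (\<Sum>i\<in>UNIV. \<Sum>j\<in>UNIV. (\<Sum>l<n. V i l * cnj (V j l)) * B $ i $ j)"
      by (simp only: Re_complex_of_real)
    also have "\<dots> \<le> c * d\<^sup>2" using adm [OF \<open>psd B\<close>] Bd by linarith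
    finally have qX: "(\<Sum>l<n. q (X l)) \<le> c * d\<^sup>2" .
    have "?X = (\<Sum>l<n. S (X l) (h l))"
      unfolding X_def S_xs_h cinner_sum_right ..
    then have "Re ?X \<le> cmod (\<Sum>l<n. S (X l) (h l))" using complex_Re_le_cmod [of ?X] by (simp only:)
    also have "\<dots> \<le> (\<Sum>l<n. \<bar>sqrt (q (X l))\<bar> * \<bar>sqrt (q (h l))\<bar>)"
      by (rule order_trans [OF norm_sum sum_mono]) (simp add: S_cs q0)
    also have "\<dots> \<le> L2_set (\<lambda>l. sqrt (q (X l))) {..<n} * L2_set (\<lambda>l. sqrt (q (h l))) {..<n}"
      by (rule L2_set_mult_ineq)
    also have "\<dots> = sqrt (\<Sum>l<n. q (X l)) * sqrt (\<Sum>l<n. q (h l))"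
      by (simp add: L2_set_def q0)
    also have "\<dots> \<le> sqrt (c * d\<^sup>2) * sqrt (\<Sum>l<n. q (h l))"
      using qX by (intro mult_right_mono) (auto intro!: sum_nonneg q0)
    finally show ?thesis by (simp add: real_sqrt_mult d0 q_def)
  qed
  have "((\<lambda>e. sqrt c * d * sqrt (\<Sum>l<n. e * norm_sq k (h l) + defect k W (h l))) \<longlongrightarrow>
      sqrt c * d * sqrt (\<Sum>l<n. 0 * norm_sq k (h l) + defect k W (h l))) (at_right 0)"
    by (intro tendsto_intros)
  moreover have "\<forall>\<^sub>F e in at_right 0. Re ?X \<le> sqrt c * d * sqrt (\<Sum>l<n. e * norm_sq k (h l) + defect k W (h l))"
    by (rule eventually_mono [OF eventually_at_right_less]) (rule eps)
  ultimately have "Re ?X \<le> sqrt c * d * sqrt (\<Sum>l<n. 0 * norm_sq k (h l) + defect k W (h l))"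
    by (rule tendsto_lowerbound) simp
  then show ?thesis by (simp add: d_def)
qed

text \<open>
  Let \<open>g\<close> be the first component of the image of \<open>(a, h)\<close>. Pairing it with itself gives
  \<open>\<parallel>g\<parallel>\<^sup>2 \<le> \<parallel>W\<^sup>* g\<parallel> \<parallel>a\<parallel> + sqrt c (\<parallel>g\<parallel>\<^sup>2 - \<parallel>W\<^sup>* g\<parallel>\<^sup>2)\<^sup>1\<^sup>/\<^sup>2 D\<^sup>1\<^sup>/\<^sup>2\<close>, where \<open>D\<close> is the sum of the
  defects of the \<open>h\<^sub>l\<close>. As \<open>c \<ge> 1\<close>, the Cauchy-Schwarz inequality in the plane turns this into
  \<open>\<parallel>g\<parallel>\<^sup>2 \<le> c (\<parallel>a\<parallel>\<^sup>2 + D)\<close>, and the remaining components of the image add back what \<open>D\<close>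
  lacks.
\<close>
lemma block_operator_bound:
  assumes con: "\<And>h. norm_sq k (app_mat k W h) \<le> norm_sq k h"
    and mid: "\<And>g. Re (\<Sum>l<n. cinner k g (X l)) \<le> sqrt c * sqrt (defect k (conj_transp W) g) * sqrt (\<Sum>l<n. defect k W (h l))"
    and c: "1 \<le> c"
  shows "norm_sq k (\<lambda>p. app_mat k W a p + (\<Sum>l<n. X l p)) + (\<Sum>l<n. norm_sq k (app_mat k W (h l)))
      \<le> c * (norm_sq k a + (\<Sum>l<n. norm_sq k (h l)))"
proof -
  define g where "g = (\<lambda>p. app_mat k W a p + (\<Sum>l<n. X l p))"
  define s where "s = norm_sq k (app_mat k (conj_transp W) g)"
  define D where "D = (\<Sum>l<n. defect k W (h l))"
  have sG: "s \<le> norm_sq k g" unfolding s_def by (rule norm_sq_conj_transp_le [OF con])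
  have D0: "0 \<le> D" unfolding D_def by (intro sum_nonneg defect_nonneg con)
  have "complex_of_real (norm_sq k g) = cinner k g (app_mat k W a) + (\<Sum>l<n. cinner k g (X l))"
    using cinner_sum_right [of k g "\<lambda>l. 1" X "{..<n}"]
    unfolding cinner_self [symmetric] by (subst (2) g_def) (simp add: cinner_add_right)
  then have "Re (complex_of_real (norm_sq k g)) = Re (cinner k (app_mat k (conj_transp W) g) a + (\<Sum>l<n. cinner k g (X l)))"
    unfolding cinner_app_mat_conj_transp by (rule arg_cong)
  then have "norm_sq k g = Re (cinner k (app_mat k (conj_transp W) g) a) + Re (\<Sum>l<n. cinner k g (X l))"
    by (simp only: plus_complex.sel Re_complex_of_real)
  also have "\<dots> \<le> sqrt s * sqrt (norm_sq k a) + sqrt c * sqrt (norm_sq k g - s) * sqrt D"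
    using mid [of g] cmod_cinner_le [of k "app_mat k (conj_transp W) g" a] complex_Re_le_cmod [of "cinner k (app_mat k (conj_transp W) g) a"]
    unfolding s_def D_def defect_def [of k "conj_transp W"] by linarith
  also have "\<dots> \<le> sqrt c * (sqrt s * sqrt (norm_sq k a)) + sqrt c * sqrt (norm_sq k g - s) * sqrt D"
    using c mult_right_mono [of 1 "sqrt c" "sqrt s * sqrt (norm_sq k a)"] by (simp add: s_def)
  also have "\<dots> = sqrt c * (sqrt s * sqrt (norm_sq k a) + sqrt (norm_sq k g - s) * sqrt D)"
    by (simp add: algebra_simps)
  also have "\<dots> \<le> sqrt c * (sqrt (s + (norm_sq k g - s)) * sqrt (norm_sq k a + D))"
    using c sG D0 by (intro mult_left_mono cauchy_schwarz_pair) (auto simp: s_def)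
  finally have "sqrt (norm_sq k g) * sqrt (norm_sq k g) \<le> sqrt (c * (norm_sq k a + D)) * sqrt (norm_sq k g)"
    by (simp add: real_sqrt_mult mult_ac)
  then have "sqrt (norm_sq k g) \<le> sqrt (c * (norm_sq k a + D))"
    using c D0 by - (rule le_of_square_le_mult, auto)
  then have "norm_sq k g \<le> c * (norm_sq k a + D)" by simp
  moreover have "(\<Sum>l<n. norm_sq k (app_mat k W (h l))) \<le> c * (\<Sum>l<n. norm_sq k (app_mat k W (h l)))"
    using c mult_right_mono [of 1 c "\<Sum>l<n. norm_sq k (app_mat k W (h l))"] by (simp add: sum_nonneg)
  ultimately have "norm_sq k g + (\<Sum>l<n. norm_sq k (app_mat k W (h l)))
      \<le> c * (norm_sq k a + (D + (\<Sum>l<n. norm_sq k (app_mat k W (h l)))))"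
    by (simp add: ring_distribs)
  also have "D + (\<Sum>l<n. norm_sq k (app_mat k W (h l))) = (\<Sum>l<n. norm_sq k (h l))"
    unfolding D_def defect_def by (simp add: sum_subtractf)
  finally show ?thesis unfolding g_def .
qed

section \<open>Norms, dual norms and injective norms\<close>

lemma is_normD:
  assumes "is_norm N"
  shows is_norm_nonneg: "0 \<le> N z" and is_norm_eq_0: "N z = 0 \<Longrightarrow> z = 0"
    and is_norm_scale: "N (c *s z) = cmod c * N z" and is_norm_add: "N (z + w) \<le> N z + N w"
  using assms by (auto simp: is_norm_def)

lemma is_norm_0: "is_norm N \<Longrightarrow> N 0 = 0"
  using is_norm_scale [of N 0 0] by simp

lemma is_norm_sum: "is_norm N \<Longrightarrow> N (\<Sum>j\<in>J. f j) \<le> (\<Sum>j\<in>J. N (f j))"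
proof (induction J rule: infinite_finite_induct)
  case (insert x F)
  then show ?case
    using is_norm_add [of N "f x" "sum f F"] by force
qed (auto simp: is_norm_0)

lemma is_norm_le_sum:
  assumes "is_norm N"
  shows "N z \<le> (\<Sum>j\<in>UNIV. cmod (z $ j) * N (axis j 1))"
  using is_norm_sum [OF assms, of "\<lambda>j. z $ j *s axis j 1" UNIV]
  by (simp add: basis_expansion is_norm_scale [OF assms])

lemma of_real_vec_scale: "complex_of_real r *s z = r *\<^sub>R z"
  by (simp add: Finite_Cartesian_Product.vec_eq_iff of_real_def)

lemma scaleR_vec_nth: "(r *\<^sub>R z) $ j = complex_of_real r * z $ j"
  unfolding of_real_vec_scale [symmetric] by (rule vector_smult_component)

lemma is_norm_scaleR: "is_norm N \<Longrightarrow> N (r *\<^sub>R z) = \<bar>r\<bar> * N z"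
  by (metis is_norm_scale norm_of_real of_real_vec_scale)

lemma is_norm_le_norm:
  assumes "is_norm N"
  shows "N z \<le> (\<Sum>j\<in>UNIV. N (axis j 1)) * norm z"
proof -
  have "N z \<le> (\<Sum>j\<in>UNIV. cmod (z $ j) * N (axis j 1))" by (rule is_norm_le_sum [OF assms])
  also have "\<dots> \<le> (\<Sum>j\<in>UNIV. norm z * N (axis j 1))"
    by (intro sum_mono mult_right_mono Finite_Cartesian_Product.norm_nth_le is_norm_nonneg [OF assms])
  finally show ?thesis by (simp add: sum_distrib_left mult.commute)
qed

lemma is_norm_continuous:
  assumes "is_norm N"
  shows "continuous_on UNIV N"
proof -
  define C where "C = (\<Sum>j\<in>UNIV. N (axis j 1))"
  have "C-lipschitz_on UNIV N"
  proof (rule lipschitz_onI)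
    fix x y :: "complex ^ 'a"
    have "N x \<le> N y + N (x - y)" "N y \<le> N x + N (y - x)"
      using is_norm_add [OF assms, of y "x - y"] is_norm_add [OF assms, of x "y - x"] by auto
    moreover have "N (x - y) \<le> C * norm (x - y)" "N (y - x) \<le> C * norm (x - y)"
      using is_norm_le_norm [OF assms, of "x - y"] is_norm_le_norm [OF assms, of "y - x"]
      by (auto simp: C_def norm_minus_commute)
    ultimately show "dist (N x) (N y) \<le> C * dist x y"
      by (simp add: dist_norm abs_le_iff)
  qed (auto simp: C_def intro!: sum_nonneg is_norm_nonneg [OF assms])
  then show ?thesis by (rule lipschitz_on_continuous_on)
qed

text \<open>
  The sphere is compact and the norm is continuous, so the norm has a positive minimum on it.
\<close>
lemma is_norm_equiv:
  fixes N :: "complex ^ 'm \<Rightarrow> real"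
  assumes "is_norm N"
  obtains K where "0 < K" "\<And>z. norm z \<le> K * N z"
proof -
  have "\<exists>x\<in>sphere 0 1. \<forall>y\<in>sphere 0 1. N x \<le> N y"
  proof (rule continuous_attains_inf)
    show "continuous_on (sphere 0 1) N"
      using is_norm_continuous [OF assms] continuous_on_subset by blast
    have "norm (axis undefined 1 :: complex ^ 'm) = 1" by simp
    then have "axis undefined 1 \<in> sphere (0 :: complex ^ 'm) 1" by simp
    then show "sphere (0 :: complex ^ 'm) 1 \<noteq> {}" by blast
  qed simp
  then obtain x where x: "norm x = 1" "\<And>y. norm y = 1 \<Longrightarrow> N x \<le> N y" by auto
  have pos: "0 < N x"
    using is_norm_nonneg [OF assms, of x] is_norm_eq_0 [OF assms, of x] x(1)
    by (metis less_le norm_zero zero_neq_one)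
  have "norm z \<le> (1 / N x) * N z" for z
  proof (cases "z = 0")
    case False
    then have "N x \<le> N ((1 / norm z) *\<^sub>R z)" by (intro x(2)) simp
    also have "\<dots> = N z / norm z" by (simp add: is_norm_scaleR [OF assms])
    finally show ?thesis using False pos by (simp add: field_simps)
  qed (simp add: is_norm_nonneg [OF assms] is_norm_0 [OF assms])
  with pos show ?thesis by (intro that [of "1 / N x"]) auto
qed

lemma cmod_bilinear_le: "cmod (\<Sum>j\<in>UNIV. x $ j * z $ j) \<le> (\<Sum>j\<in>UNIV. cmod (x $ j)) * norm z"
proof -
  have "cmod (\<Sum>j\<in>UNIV. x $ j * z $ j) \<le> (\<Sum>j\<in>UNIV. cmod (x $ j) * cmod (z $ j))"
    by (rule order_trans [OF norm_sum]) (simp add: norm_mult)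
  also have "\<dots> \<le> (\<Sum>j\<in>UNIV. cmod (x $ j) * norm z)"
    by (intro sum_mono mult_left_mono Finite_Cartesian_Product.norm_nth_le) auto
  finally show ?thesis by (simp add: sum_distrib_right)
qed

lemma dual_norm_bdd:
  assumes "is_norm N"
  shows "bdd_above ((\<lambda>z. cmod (\<Sum>j\<in>UNIV. x $ j * z $ j)) ` {z. N z \<le> 1})"
proof -
  obtain K where K: "0 < K" "\<And>z. norm z \<le> K * N z" using is_norm_equiv [OF assms] by blast
  have "cmod (\<Sum>j\<in>UNIV. x $ j * z $ j) \<le> (\<Sum>j\<in>UNIV. cmod (x $ j)) * (K * 1)" if "N z \<le> 1" for z
  proof (rule order_trans [OF cmod_bilinear_le mult_left_mono])
    show "norm z \<le> K * 1"
      using K(2) [of z] mult_left_mono [OF that, of K] K(1) by linarith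
  qed (simp add: sum_nonneg)
  then show ?thesis by (intro bdd_aboveI2) auto
qed

lemma dual_norm_le:
  assumes "is_norm N" "\<And>z. N z \<le> 1 \<Longrightarrow> cmod (\<Sum>j\<in>UNIV. x $ j * z $ j) \<le> b"
  shows "dual_norm N x \<le> b"
  unfolding dual_norm_def
  by (rule cSUP_least) (use assms in \<open>auto intro!: exI [of _ 0] simp: is_norm_0\<close>)

lemma dual_norm_upper1:
  assumes "is_norm N" "N z \<le> 1"
  shows "cmod (\<Sum>j\<in>UNIV. x $ j * z $ j) \<le> dual_norm N x"
  unfolding dual_norm_def by (rule cSUP_upper) (use assms dual_norm_bdd in auto)

lemma dual_norm_upper:
  assumes "is_norm N"
  shows "cmod (\<Sum>j\<in>UNIV. x $ j * z $ j) \<le> dual_norm N x * N z"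
proof (cases "N z = 0")
  case True
  then have "z = 0" by (rule is_norm_eq_0 [OF assms])
  then show ?thesis by (simp add: is_norm_0 [OF assms])
next
  case False
  then have pos: "0 < N z" using is_norm_nonneg [OF assms, of z] by simp
  have "cmod (\<Sum>j\<in>UNIV. x $ j * ((1 / N z) *\<^sub>R z) $ j) \<le> dual_norm N x"
    using pos by (intro dual_norm_upper1 [OF assms]) (simp add: is_norm_scaleR [OF assms])
  also have "(\<Sum>j\<in>UNIV. x $ j * ((1 / N z) *\<^sub>R z) $ j) = (1 / N z) *\<^sub>R (\<Sum>j\<in>UNIV. x $ j * z $ j)"
    by (simp add: scaleR_right.sum)
  finally show ?thesis using pos by (simp add: field_simps)
qed

lemma is_norm_dual_norm:
  assumes N: "is_norm N"
  shows "is_norm (dual_norm N)"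
  unfolding is_norm_def
proof (intro conjI allI impI)
  show nn: "0 \<le> dual_norm N z" for z
    using dual_norm_upper1 [OF N, of 0 z] is_norm_0 [OF N] by simp
  show "z = 0" if "dual_norm N z = 0" for z
  proof -
    have "z $ j = 0" for j
      using dual_norm_upper [OF N, of z "axis j 1"] that by (simp add: axis_def if_distrib cong: if_cong)
    then show ?thesis by (simp add: Finite_Cartesian_Product.vec_eq_iff)
  qed
  have le: "dual_norm N (c *s z) \<le> cmod c * dual_norm N z" for c z
  proof (rule dual_norm_le [OF N])
    fix w assume "N w \<le> 1"
    then have "cmod c * cmod (\<Sum>j\<in>UNIV. z $ j * w $ j) \<le> cmod c * dual_norm N z"
      by (intro mult_left_mono dual_norm_upper1 [OF N]) auto
    then show "cmod (\<Sum>j\<in>UNIV. (c *s z) $ j * w $ j) \<le> cmod c * dual_norm N z"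
      by (simp add: mult.assoc norm_mult flip: sum_distrib_left)
  qed
  show "dual_norm N (c *s z) = cmod c * dual_norm N z" for c z
  proof (cases "c = 0")
    case True
    then show ?thesis using le [of 0 z] nn [of "0 *s z"] by simp
  next
    case False
    have "dual_norm N z = dual_norm N ((1 / c) *s (c *s z))"
      using False by (simp add: vector_smult_assoc)
    also have "\<dots> \<le> cmod (1 / c) * dual_norm N (c *s z)" by (rule le)
    finally have "cmod c * dual_norm N z \<le> dual_norm N (c *s z)"
      using False by (simp add: norm_divide field_simps)
    with le [of c z] show ?thesis by simp
  qed
  show "dual_norm N (z + w) \<le> dual_norm N z + dual_norm N w" for z w
  proof (rule dual_norm_le [OF N])
    fix y assume y: "N y \<le> 1"
    have "cmod (\<Sum>j\<in>UNIV. (z + w) $ j * y $ j)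
        \<le> cmod (\<Sum>j\<in>UNIV. z $ j * y $ j) + cmod (\<Sum>j\<in>UNIV. w $ j * y $ j)"
      by (simp add: ring_distribs sum.distrib norm_triangle_ineq)
    with dual_norm_upper1 [OF N y, of z] dual_norm_upper1 [OF N y, of w]
    show "cmod (\<Sum>j\<in>UNIV. (z + w) $ j * y $ j) \<le> dual_norm N z + dual_norm N w" by linarith
  qed
qed

abbreviation sesq :: "complex ^ 'm ^ 'm \<Rightarrow> complex ^ 'm \<Rightarrow> complex ^ 'm \<Rightarrow> complex" where
  "sesq A x y \<equiv> \<Sum>i\<in>UNIV. \<Sum>j\<in>UNIV. A $ i $ j * x $ i * cnj (y $ j)"

lemma sesq_sup_le:
  assumes "is_norm M" "\<And>x y. M x \<le> 1 \<Longrightarrow> M y \<le> 1 \<Longrightarrow> cmod (sesq A x y) \<le> b"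
  shows "sesq_sup M A \<le> b"
  unfolding sesq_sup_def
  by (rule cSUP_least) (use assms in \<open>auto intro!: exI [of _ 0] simp: is_norm_0\<close>)

lemma sesq_sup_upper:
  assumes M: "is_norm M" and x: "M x \<le> 1" and y: "M y \<le> 1"
  shows "cmod (sesq A x y) \<le> sesq_sup M A"
proof -
  obtain K where K: "0 < K" "\<And>z. norm z \<le> K * M z" using is_norm_equiv [OF M] by blast
  have nK: "norm z \<le> K" if "M z \<le> 1" for z
    using K(2) [of z] mult_left_mono [OF that, of K] K(1) by linarith
  have b: "cmod (sesq A x y) \<le> (\<Sum>i\<in>UNIV. \<Sum>j\<in>UNIV. cmod (A $ i $ j) * K * K)"
    if "M x \<le> 1" "M y \<le> 1" for x y
  proof (intro order_trans [OF norm_sum sum_mono])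
    fix i j
    have "cmod (x $ i) \<le> K" "cmod (y $ j) \<le> K"
      using nK that Finite_Cartesian_Product.norm_nth_le order_trans by blast+
    then show "cmod (A $ i $ j * x $ i * cnj (y $ j)) \<le> cmod (A $ i $ j) * K * K"
      using K(1) by (auto simp: norm_mult intro!: mult_mono)
  qed
  have "(case (x, y) of (x, y) \<Rightarrow> cmod (sesq A x y)) \<le> sesq_sup M A"
    unfolding sesq_sup_def
    by (rule cSUP_upper) (use x y b in \<open>auto intro!: bdd_aboveI2\<close>)
  then show ?thesis by simp
qed

lemma sesq_sup_nonneg: "is_norm M \<Longrightarrow> 0 \<le> sesq_sup M A"
  using sesq_sup_upper [of M 0 0 A] by (simp add: is_norm_0)

lemma sesq_axis: "sesq A (axis i a) (axis j b) = A $ i $ j * a * cnj b"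
proof -
  have "sesq A (axis i a) (axis j b)
      = (\<Sum>i'\<in>UNIV. \<Sum>j'\<in>UNIV. if j' = j then (if i' = i then A $ i $ j * a * cnj b else 0) else 0)"
    by (intro sum.cong) (auto simp: axis_def)
  then show ?thesis by simp
qed

lemma is_norm_axis_pos: "is_norm M \<Longrightarrow> 0 < M (axis i 1)"
  using is_norm_nonneg [of M "axis i 1"] is_norm_eq_0 [of M "axis i 1"]
  by (metis axis_eq_0_iff less_le zero_neq_one)

text \<open>
  Evaluate the form at normalised coordinate vectors.
\<close>
lemma entry_le_sesq_sup:
  assumes M: "is_norm M"
  shows "cmod (A $ i $ j) \<le> sesq_sup M A * (M (axis i 1) * M (axis j 1))"
proof -
  have "(axis i (complex_of_real (1 / M (axis i 1))) :: complex ^ 'a) = (1 / M (axis i 1)) *\<^sub>R axis i 1" for i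
    by (simp add: axis_def Finite_Cartesian_Product.vec_eq_iff of_real_def)
  then have "M (axis i (complex_of_real (1 / M (axis i 1)))) \<le> 1" for i
    using is_norm_axis_pos [OF M, of i] by (simp add: is_norm_scaleR [OF M])
  then have "cmod (sesq A (axis i (complex_of_real (1 / M (axis i 1)))) (axis j (complex_of_real (1 / M (axis j 1)))))
      \<le> sesq_sup M A"
    by (intro sesq_sup_upper [OF M])
  then show ?thesis
    using is_norm_axis_pos [OF M, of i] is_norm_axis_pos [OF M, of j]
    unfolding sesq_axis by (simp add: norm_mult norm_divide field_simps)
qed

lemma sesq_scaleR: "sesq (r *\<^sub>R A) x y = r *\<^sub>R sesq A x y"
  by (simp add: scaleR_right.sum)

lemma sesq_sup_scaleR_le:
  assumes M: "is_norm M" and r: "0 \<le> r"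
  shows "sesq_sup M (r *\<^sub>R A) \<le> r * sesq_sup M A"
  by (rule sesq_sup_le [OF M], unfold sesq_scaleR)
    (use r in \<open>auto intro!: mult_left_mono sesq_sup_upper [OF M]\<close>)

lemma psd_scaleR: "psd A \<Longrightarrow> 0 \<le> r \<Longrightarrow> psd (r *\<^sub>R A)"
proof -
  assume A: "psd A" and r: "0 \<le> r"
  have "(\<Sum>i\<in>UNIV. \<Sum>j\<in>UNIV. cnj (x $ i) * (r *\<^sub>R A) $ i $ j * x $ j)
      = r *\<^sub>R (\<Sum>i\<in>UNIV. \<Sum>j\<in>UNIV. cnj (x $ i) * A $ i $ j * x $ j)" for x
    by (simp add: scaleR_right.sum)
  then show "psd (r *\<^sub>R A)"
    using A r unfolding psd_def
    by (metis (no_types, lifting) complex_cnj_scaleR complex_scaleR(1) mult_nonneg_nonneg scaleR_complex.sel(1) vector_scaleR_component)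
qed

section \<open>Positive semidefinite matrices as Gram matrices\<close>

text \<open>
  The quadratic form on one more index, as a polynomial in the new coordinate; its minimum over
  that coordinate is the form of the Schur complement.
\<close>
lemma kernel_form_insert:
  fixes K :: "'i \<Rightarrow> 'i \<Rightarrow> complex"
  assumes fin: "finite I" and i0: "i0 \<notin> I"
    and herm: "\<And>i j. K i j = cnj (K j i)"
  defines "s x \<equiv> \<Sum>j\<in>I. K i0 j * x j"
  shows "(\<Sum>i\<in>insert i0 I. \<Sum>j\<in>insert i0 I. cnj (x i) * K i j * x j)
      = cnj (x i0) * K i0 i0 * x i0 + (cnj (x i0) * s x + cnj (s x) * x i0)
        + (\<Sum>i\<in>I. \<Sum>j\<in>I. cnj (x i) * K i j * x j)"
proof -
  have "cnj (s x) = (\<Sum>i\<in>I. cnj (x i) * K i i0)"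
    unfolding s_def by (simp add: herm [of _ i0] mult.commute)
  then have "cnj (s x) * x i0 = (\<Sum>i\<in>I. cnj (x i) * K i i0 * x i0)"
    by (simp add: sum_distrib_right)
  moreover have "cnj (x i0) * s x = (\<Sum>j\<in>I. cnj (x i0) * K i0 j * x j)"
    by (simp add: s_def sum_distrib_left mult.assoc)
  ultimately show ?thesis
    using fin i0 by (simp add: sum.distrib)
qed

text \<open>
  A Cholesky factorisation, by induction on the index set. Minimising the form over the
  coordinate \<open>i0\<close> shows that the Schur complement \<open>K'\<close> is again positive; a factorisation of
  \<open>K'\<close> is extended by one further column, which is that of \<open>i0\<close> in \<open>K\<close> divided by
  \<open>sqrt (K i0 i0)\<close>. If \<open>K i0 i0 = 0\<close>, positivity forces this whole column to vanish, and
  division by 0 yields the right values.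
\<close>
lemma psd_kernel_gram:
  fixes K :: "'i \<Rightarrow> 'i \<Rightarrow> complex"
  assumes "finite I" and "\<And>i j. K i j = cnj (K j i)"
    and "\<And>x. 0 \<le> Re (\<Sum>i\<in>I. \<Sum>j\<in>I. cnj (x i) * K i j * x j)"
  shows "\<exists>v :: 'i \<Rightarrow> nat \<Rightarrow> complex. \<forall>i\<in>I. \<forall>j\<in>I. K i j = (\<Sum>a<card I. v i a * cnj (v j a))"
  using assms
proof (induction I arbitrary: K rule: finite_induct)
  case empty
  show ?case by simp
next
  case (insert i0 I)
  note herm = insert.prems(1) and pos = insert.prems(2)
  define s where "s x = (\<Sum>j\<in>I. K i0 j * x j)" for x
  define F where "F x = (\<Sum>i\<in>I. \<Sum>j\<in>I. cnj (x i) * K i j * x j)" for x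
  have form: "(\<Sum>i\<in>insert i0 I. \<Sum>j\<in>insert i0 I. cnj (x i) * K i j * x j)
      = cnj (x i0) * K i0 i0 * x i0 + (cnj (x i0) * s x + cnj (s x) * x i0) + F x" for x
    unfolding s_def F_def by (rule kernel_form_insert [OF insert.hyps(1,2) herm])
  define r where "r = Re (K i0 i0)"
  have Koo: "K i0 i0 = of_real r"
    using arg_cong [OF herm [of i0 i0], of Im] by (simp add: r_def complex_eq_iff)
  have ext: "s (x(i0 := t)) = s x" "F (x(i0 := t)) = F x" for x t
    using insert.hyps(2) by (auto simp: s_def F_def intro!: sum.cong)
  have pos': "0 \<le> r * (cmod t)\<^sup>2 + 2 * Re (cnj t * s x) + Re (F x)" for x t
  proof -
    have 1: "cnj t * s x + cnj (s x) * t = of_real (2 * Re (cnj t * s x))"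
      using complex_add_cnj [of "cnj t * s x"] by (simp add: mult.commute)
    have 2: "cnj t * of_real r * t = of_real (r * (cmod t)\<^sup>2)"
      unfolding of_real_mult complex_norm_square by (simp add: mult_ac)
    show ?thesis
      using pos [of "x(i0 := t)"] unfolding form ext fun_upd_same Koo 1 2
      by (simp only: plus_complex.sel Re_complex_of_real)
  qed
  have r0: "0 \<le> r"
    using pos' [of 1 "\<lambda>_. 0"] by (simp add: s_def F_def)
  have zero: "K i0 j = 0" if "r = 0" "j \<in> I" for j
  proof (rule ccontr)
    assume nz: "K i0 j \<noteq> 0"
    define x where "x = (\<lambda>i. if i = j then 1 else 0 :: complex)"
    have s: "s x = K i0 j"
      using that insert.hyps(1) by (simp add: s_def x_def if_distrib cong: if_cong)
    define b where "b = \<bar>Re (F x)\<bar> + 1"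
    (* with K i0 i0 = 0 the form is affine along K i0 j; this step makes it negative *)
    define t where "t = - of_real (b / (2 * (cmod (K i0 j))\<^sup>2)) * K i0 j"
    have "2 * Re (cnj t * s x) = - b"
    proof -
      have "cnj t * s x = - of_real (b / (2 * (cmod (K i0 j))\<^sup>2)) * of_real ((cmod (K i0 j))\<^sup>2)"
        unfolding t_def s complex_norm_square by (simp add: mult_ac del: of_real_divide of_real_add of_real_mult)
      also have "\<dots> = of_real (- b / 2)"
        unfolding of_real_mult [symmetric] of_real_minus [symmetric] using nz by simp
      finally show ?thesis by simp
    qed
    with pos' [of t x] \<open>r = 0\<close> show False by (simp add: b_def)
  qed
  define K' where "K' i j = K i j - K i i0 * cnj (K j i0) / of_real r" for i j
  have "0 \<le> Re (\<Sum>i\<in>I. \<Sum>j\<in>I. cnj (x i) * K' i j * x j)" for x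
  proof -
    have sx: "(\<Sum>j\<in>I. cnj (K j i0) * x j) = s x"
      unfolding s_def by (simp add: herm [of i0])
    have csx: "(\<Sum>i\<in>I. cnj (x i) * K i i0) = cnj (s x)"
      unfolding s_def by (simp add: herm [of _ i0] mult.commute)
    have "(\<Sum>i\<in>I. \<Sum>j\<in>I. cnj (x i) * K' i j * x j)
        = F x - (\<Sum>i\<in>I. \<Sum>j\<in>I. (cnj (x i) * K i i0) * (cnj (K j i0) * x j)) / of_real r"
      unfolding F_def K'_def sum_divide_distrib sum_subtractf [symmetric]
      by (intro sum.cong refl) (simp add: algebra_simps)
    also have "(\<Sum>i\<in>I. \<Sum>j\<in>I. (cnj (x i) * K i i0) * (cnj (K j i0) * x j)) = of_real ((cmod (s x))\<^sup>2)"
      unfolding sum_product [symmetric] sx csx complex_norm_square by (rule mult.commute)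
    finally have "Re (\<Sum>i\<in>I. \<Sum>j\<in>I. cnj (x i) * K' i j * x j) = Re (F x) - (cmod (s x))\<^sup>2 / r"
      by (simp flip: of_real_power of_real_divide)
    also have "\<dots> \<ge> 0"
    proof -
      have "Re (cnj (- s x / of_real r) * s x) = - ((cmod (s x))\<^sup>2 / r)"
      proof -
        have "cnj (- s x / of_real r) * s x = - (of_real ((cmod (s x))\<^sup>2) / of_real r)"
          unfolding complex_norm_square by (simp add: mult.commute)
        then show ?thesis by (simp flip: of_real_power of_real_divide)
      qed
      moreover have "r * (cmod (- s x / of_real r))\<^sup>2 = (cmod (s x))\<^sup>2 / r"
        by (simp add: norm_divide power_divide power2_eq_square)
      ultimately show ?thesis using pos' [of "- s x / of_real r" x] by linarith
    qed
    finally show ?thesis .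
  qed
  moreover have "K' i j = cnj (K' j i)" for i j
    unfolding K'_def using herm [of i j] by (simp add: mult.commute)
  ultimately obtain v where v: "\<And>i j. i \<in> I \<Longrightarrow> j \<in> I \<Longrightarrow> K' i j = (\<Sum>a<card I. v i a * cnj (v j a))"
    using insert.IH [of K'] by metis
  define w where "w i a = (if i = i0 then (if a = card I then of_real (sqrt r) else 0)
      else if a = card I then K i i0 / of_real (sqrt r) else v i a)" for i a
  have rr: "complex_of_real (sqrt r) * of_real (sqrt r) = of_real r"
    using r0 by (simp flip: of_real_mult)
  have "K i j = (\<Sum>a<card (insert i0 I). w i a * cnj (w j a))" if ij: "i \<in> insert i0 I" "j \<in> insert i0 I" for i j
  proof -
    have split: "(\<Sum>a<card (insert i0 I). w i a * cnj (w j a))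
        = (\<Sum>a<card I. w i a * cnj (w j a)) + w i (card I) * cnj (w j (card I))"
      using insert.hyps by simp
    have Kio: "K i i0 = 0" if "r = 0" "i \<in> I" for i
      using zero [OF that] herm [of i i0] by simp
    consider "i = i0" "j = i0" | "i = i0" "j \<in> I" "j \<noteq> i0" | "i \<in> I" "i \<noteq> i0" "j = i0" | "i \<in> I" "j \<in> I" "i \<noteq> i0" "j \<noteq> i0"
      using ij insert.hyps(2) by blast
    then show ?thesis
    proof cases
      case 1
      then show ?thesis unfolding split by (simp add: w_def rr Koo)
    next
      case 2
      then show ?thesis unfolding split
        using zero [of j] r0 herm [of i0 j] by (cases "r = 0") (auto simp: w_def)
    next
      case 3
      then show ?thesis unfolding split
        using Kio [of i] r0 by (cases "r = 0") (auto simp: w_def)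
    next
      case 4
      have "(\<Sum>a<card I. w i a * cnj (w j a)) = K' i j"
        using 4 by (simp add: v w_def)
      moreover have "w i (card I) * cnj (w j (card I)) = K i i0 * cnj (K j i0) / of_real r"
        using 4 by (simp add: w_def rr)
      ultimately show ?thesis unfolding split by (simp add: K'_def)
    qed
  qed
  then show ?case by blast
qed

lemma psd_imp_gram:
  fixes A :: "complex ^ 'm ^ 'm"
  assumes "psd A"
  obtains v :: "'m \<Rightarrow> nat \<Rightarrow> complex"
  where "\<And>i j. A $ i $ j = (\<Sum>a<CARD('m). v i a * cnj (v j a))"
proof -
  have pos: "0 \<le> Re (\<Sum>i\<in>UNIV. \<Sum>j\<in>UNIV. cnj (x i) * A $ i $ j * x j)" for x
    using assms unfolding psd_def by (metis (no_types, lifting) sum.cong vec_lambda_beta)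
  have herm: "A $ i $ j = cnj (A $ j $ i)" for i j
    using assms unfolding psd_def by blast
  have "\<exists>v :: 'm \<Rightarrow> nat \<Rightarrow> complex. \<forall>i\<in>UNIV. \<forall>j\<in>UNIV. A $ i $ j = (\<Sum>a<CARD('m). v i a * cnj (v j a))"
    by (rule psd_kernel_gram [of UNIV "\<lambda>i j. A $ i $ j", OF finite_class.finite_UNIV herm pos])
  then show ?thesis using that by blast
qed

definition lin_comb :: "('m::finite \<Rightarrow> nat \<Rightarrow> complex) \<Rightarrow> complex ^ 'm \<Rightarrow> nat \<Rightarrow> complex" where
  "lin_comb v x = (\<lambda>a. \<Sum>i\<in>UNIV. x $ i * v i a)"

definition gram :: "nat \<Rightarrow> ('m::finite \<Rightarrow> nat \<Rightarrow> complex) \<Rightarrow> complex ^ 'm ^ 'm" where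
  "gram n v = (\<chi> i j. \<Sum>a<n. v i a * cnj (v j a))"

lemma sesq_gram: "sesq (gram n v) x y = cinner n (lin_comb v y) (lin_comb v x)"
proof -
  have "sesq (gram n v) x y = (\<Sum>i\<in>UNIV. \<Sum>j\<in>UNIV. \<Sum>a<n. (x $ i * v i a) * cnj (y $ j * v j a))"
    by (simp add: gram_def sum_distrib_right sum_distrib_left mult_ac)
  also have "\<dots> = (\<Sum>a<n. \<Sum>i\<in>UNIV. \<Sum>j\<in>UNIV. (x $ i * v i a) * cnj (y $ j * v j a))"
    unfolding sum.swap [of _ "{..<n}" UNIV] ..
  also have "\<dots> = cinner n (lin_comb v y) (lin_comb v x)"
    unfolding cinner_def lin_comb_def cnj_sum sum_product by (subst (2) sum.swap) (simp add: mult_ac)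
  finally show ?thesis .
qed

lemma psd_gram: "psd (gram n v)"
  unfolding psd_def
proof (intro conjI allI)
  show "gram n v $ i $ j = cnj (gram n v $ j $ i)" for i j
    by (simp add: gram_def mult.commute)
  fix x :: "complex ^ 'a"
  have "(\<Sum>i\<in>UNIV. \<Sum>j\<in>UNIV. cnj (x $ i) * gram n v $ i $ j * x $ j)
      = sesq (gram n v) (\<chi> i. cnj (x $ i)) (\<chi> i. cnj (x $ i))"
    by (simp add: mult_ac)
  then show "0 \<le> Re (\<Sum>i\<in>UNIV. \<Sum>j\<in>UNIV. cnj (x $ i) * gram n v $ i $ j * x $ j)"
    unfolding sesq_gram cinner_self by simp
qed

text \<open>
  By the Cauchy-Schwarz inequality, the injective norm of a Gram matrix is determined on the
  diagonal.
\<close>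
lemma sesq_sup_gram_le:
  assumes M: "is_norm M" and le: "\<And>x. M x \<le> 1 \<Longrightarrow> norm_sq n (lin_comb v x) \<le> 1"
  shows "sesq_sup M (gram n v) \<le> 1"
proof (rule sesq_sup_le [OF M])
  fix x y assume "M x \<le> 1" "M y \<le> 1"
  then have "sqrt (norm_sq n (lin_comb v y)) * sqrt (norm_sq n (lin_comb v x)) \<le> 1 * 1"
    by (intro mult_mono) (auto simp: le)
  then show "cmod (sesq (gram n v) x y) \<le> 1"
    unfolding sesq_gram using cmod_cinner_le [of n "lin_comb v y" "lin_comb v x"] by linarith
qed

lemma norm_sq_lin_comb_le_on_ball:
  assumes M: "is_norm M" and "M x \<le> 1"
  shows "norm_sq n (lin_comb v x) \<le> sesq_sup M (gram n v)"
  using sesq_sup_upper [OF assms assms(2), of "gram n v"]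
  unfolding sesq_gram cinner_self by simp

section \<open>The constant \<open>\<gamma>\<close>\<close>

definition pairing :: "complex ^ 'm ^ 'm \<Rightarrow> complex ^ 'm ^ 'm \<Rightarrow> real" where
  "pairing A B = Re (\<Sum>i\<in>UNIV. \<Sum>j\<in>UNIV. A $ i $ j * B $ i $ j)"

definition admissible :: "(complex ^ 'm \<Rightarrow> real) \<Rightarrow> real \<Rightarrow> bool" where
  "admissible N c \<longleftrightarrow> (\<forall>A B. psd A \<longrightarrow> psd B \<longrightarrow> pairing A B \<le> c * sesq_sup (dual_norm N) A * sesq_sup N B)"

lemma gamma_const_eq_Inf: "gamma_const N = Inf {c. admissible N c}"
  by (simp add: gamma_const_def admissible_def pairing_def)

text \<open>
  Rank one matrices \<open>z z\<^sup>*\<close> and \<open>x x\<^sup>*\<close>, with \<open>z\<close> in the unit ball and \<open>x\<close> in the dual unit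
  ball, have injective norm at most 1, and their pairing is \<open>\<bar>\<Sum>\<^sub>j x\<^sub>j z\<^sub>j\<bar>\<^sup>2\<close>, which can be made as
  close to 1 as desired.
\<close>
lemma admissible_ge_1:
  fixes N :: "complex ^ 'm \<Rightarrow> real"
  assumes N: "is_norm N" and c: "admissible N c"
  shows "1 \<le> c"
proof -
  note D = is_norm_dual_norm [OF N]
  define x :: "complex ^ 'm" where "x = (1 / dual_norm N (axis undefined 1)) *\<^sub>R axis undefined 1"
  have x: "dual_norm N x = 1"
    using is_norm_axis_pos [OF D, of undefined] by (simp add: x_def is_norm_scaleR [OF D])
  (* the sign of c must come first, since the injective norms are only known to be at most 1 *)
  have key: "0 < c \<and> r\<^sup>2 < c" if r: "0 \<le> r" "r < 1" for r
  proof -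
    have "\<exists>z. N z \<le> 1 \<and> r < cmod (\<Sum>j\<in>UNIV. x $ j * z $ j)"
    proof (rule ccontr)
      assume "\<not> ?thesis"
      then have "dual_norm N x \<le> r" by (intro dual_norm_le [OF N]) force
      with r(2) x show False by simp
    qed
    then obtain z where z: "N z \<le> 1" "r < cmod (\<Sum>j\<in>UNIV. x $ j * z $ j)" by blast
    define A where "A = gram 1 (\<lambda>i _. z $ i)"
    define B where "B = gram 1 (\<lambda>i _. x $ i)"
    have combz: "lin_comb (\<lambda>i _. u $ i) y = (\<lambda>_. \<Sum>j\<in>UNIV. y $ j * u $ j)" for u y :: "complex ^ 'm"
      by (simp add: lin_comb_def)
    have "sesq_sup (dual_norm N) A \<le> 1"
      unfolding A_def
    proof (rule sesq_sup_gram_le [OF D])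
      fix y assume "dual_norm N y \<le> 1"
      then have "cmod (\<Sum>j\<in>UNIV. y $ j * z $ j) \<le> 1"
        using dual_norm_upper1 [OF N z(1), of y] by linarith
      then show "norm_sq 1 (lin_comb (\<lambda>i _. z $ i) y) \<le> 1"
        by (simp add: combz norm_sq_def power_le_one)
    qed
    moreover have "sesq_sup N B \<le> 1"
      unfolding B_def
    proof (rule sesq_sup_gram_le [OF N])
      fix y assume "N y \<le> 1"
      then have "cmod (\<Sum>j\<in>UNIV. x $ j * y $ j) \<le> 1"
        using dual_norm_upper1 [OF N, of y x] x by simp
      then show "norm_sq 1 (lin_comb (\<lambda>i _. x $ i) y) \<le> 1"
        by (simp add: combz norm_sq_def power_le_one mult.commute)
    qed
    ultimately have st: "sesq_sup (dual_norm N) A * sesq_sup N B \<le> 1"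
      "0 \<le> sesq_sup (dual_norm N) A * sesq_sup N B"
      using sesq_sup_nonneg [OF D, of A] sesq_sup_nonneg [OF N, of B] by (auto intro: mult_le_one)
    have "(\<Sum>i\<in>UNIV. \<Sum>j\<in>UNIV. A $ i $ j * B $ i $ j) = of_real ((cmod (\<Sum>j\<in>UNIV. x $ j * z $ j))\<^sup>2)"
      unfolding complex_norm_square cnj_sum sum_product
      by (simp add: A_def B_def gram_def mult_ac)
    then have "pairing A B = (cmod (\<Sum>j\<in>UNIV. x $ j * z $ j))\<^sup>2"
      unfolding pairing_def by (simp only: Re_complex_of_real)
    moreover have "pairing A B \<le> c * sesq_sup (dual_norm N) A * sesq_sup N B"
      using c psd_gram unfolding admissible_def A_def B_def by blast
    ultimately have le: "(cmod (\<Sum>j\<in>UNIV. x $ j * z $ j))\<^sup>2 \<le> c * (sesq_sup (dual_norm N) A * sesq_sup N B)"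
      by (simp add: mult.assoc)
    have lt: "r\<^sup>2 < (cmod (\<Sum>j\<in>UNIV. x $ j * z $ j))\<^sup>2"
      using z(2) r(1) by (intro power_strict_mono) auto
    with le have "0 < c * (sesq_sup (dual_norm N) A * sesq_sup N B)"
      using lt zero_le_power2 [of r] by linarith
    then have "0 < c" using st(2) by (simp add: zero_less_mult_iff)
    moreover have "c * (sesq_sup (dual_norm N) A * sesq_sup N B) \<le> c"
      using \<open>0 < c\<close> st(1) by (simp add: mult_left_le)
    ultimately show ?thesis using le lt by linarith
  qed
  show ?thesis
  proof (rule ccontr)
    assume "\<not> 1 \<le> c"
    with key [of 0] have "0 \<le> sqrt c" "sqrt c < 1" "0 < c" by auto
    with key [of "sqrt c"] show False by simp
  qed
qed

text \<open>
  Bound the pairing entry by entry.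
\<close>
lemma admissible_exists:
  fixes N :: "complex ^ 'm \<Rightarrow> real"
  assumes N: "is_norm N"
  shows "\<exists>c. admissible N c"
proof -
  define \<alpha> where "\<alpha> i j = dual_norm N (axis i 1) * dual_norm N (axis j 1)" for i j
  define \<beta> where "\<beta> i j = N (axis i 1) * N (axis j 1)" for i j
  have "pairing A B \<le> (\<Sum>i\<in>UNIV. \<Sum>j\<in>UNIV. \<alpha> i j * \<beta> i j) * sesq_sup (dual_norm N) A * sesq_sup N B" for A B
  proof -
    have "pairing A B \<le> cmod (\<Sum>i\<in>UNIV. \<Sum>j\<in>UNIV. A $ i $ j * B $ i $ j)"
      unfolding pairing_def by (rule complex_Re_le_cmod)
    also have "\<dots> \<le> (\<Sum>i\<in>UNIV. \<Sum>j\<in>UNIV. (sesq_sup (dual_norm N) A * \<alpha> i j) * (sesq_sup N B * \<beta> i j))"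
    proof (intro order_trans [OF norm_sum sum_mono])
      fix i j
      show "cmod (A $ i $ j * B $ i $ j) \<le> (sesq_sup (dual_norm N) A * \<alpha> i j) * (sesq_sup N B * \<beta> i j)"
        unfolding norm_mult \<alpha>_def \<beta>_def
        by (intro mult_mono entry_le_sesq_sup is_norm_dual_norm N mult_nonneg_nonneg
            sesq_sup_nonneg is_norm_nonneg [OF N] is_norm_nonneg [OF is_norm_dual_norm [OF N]]) auto
    qed
    finally show ?thesis by (simp add: sum_distrib_left sum_distrib_right mult_ac)
  qed
  then show ?thesis unfolding admissible_def by blast
qed

lemma gamma_const_le:
  assumes "is_norm N" "admissible N c"
  shows "gamma_const N \<le> c"
  unfolding gamma_const_eq_Inf
  by (rule cInf_lower) (use assms admissible_ge_1 [OF assms(1)] in \<open>auto intro!: bdd_belowI\<close>)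

lemma admissible_gamma_const:
  assumes N: "is_norm N"
  shows "admissible N (gamma_const N)"
  unfolding admissible_def
proof (intro allI impI)
  fix A B :: "complex ^ 'a ^ 'a" assume AB: "psd A" "psd B"
  define s where "s = sesq_sup (dual_norm N) A * sesq_sup N B"
  have s0: "0 \<le> s"
    unfolding s_def by (intro mult_nonneg_nonneg sesq_sup_nonneg is_norm_dual_norm N)
  have le: "pairing A B \<le> c * s" if "admissible N c" for c
    using that AB unfolding admissible_def s_def by (simp add: mult.assoc)
  have "pairing A B \<le> gamma_const N * s"
  proof (cases "s = 0")
    case True
    then show ?thesis using le admissible_exists [OF N] by auto
  next
    case False
    with s0 have "0 < s" by simp
    have "pairing A B / s \<le> gamma_const N"
      unfolding gamma_const_eq_Inf
      by (rule cInf_greatest)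
        (use admissible_exists [OF N] le \<open>0 < s\<close> in \<open>auto simp: divide_le_eq\<close>)
    then show ?thesis using \<open>0 < s\<close> by (simp add: divide_le_eq)
  qed
  then show "pairing A B \<le> gamma_const N * sesq_sup (dual_norm N) A * sesq_sup N B"
    by (simp add: s_def mult.assoc)
qed

lemma gamma_const_ge_1: "is_norm N \<Longrightarrow> 1 \<le> gamma_const N"
  by (rule admissible_ge_1 [OF _ admissible_gamma_const])

lemma compact_psd_ball:
  fixes M :: "complex ^ 'm \<Rightarrow> real"
  assumes M: "is_norm M"
  shows "compact {A. psd A \<and> sesq_sup M A \<le> 1}"
proof -
  have "{A. psd A \<and> sesq_sup M A \<le> 1}
      = (\<Inter>i. \<Inter>j. {A. A $ i $ j = cnj (A $ j $ i)})
        \<inter> (\<Inter>x. {A. 0 \<le> Re (\<Sum>i\<in>UNIV. \<Sum>j\<in>UNIV. cnj (x $ i) * A $ i $ j * x $ j)})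
        \<inter> (\<Inter>x\<in>{x. M x \<le> 1}. \<Inter>y\<in>{y. M y \<le> 1}. {A. cmod (sesq A x y) \<le> 1})" (is "?S = ?T")
  proof (intro equalityI subsetI)
    fix A assume "A \<in> ?S"
    then have A: "psd A" "sesq_sup M A \<le> 1" by auto
    show "A \<in> ?T"
    proof (intro IntI INT_I CollectI)
      show "A $ i $ j = cnj (A $ j $ i)" for i j
        using A(1) unfolding psd_def by blast
      show "0 \<le> Re (\<Sum>i\<in>UNIV. \<Sum>j\<in>UNIV. cnj (x $ i) * A $ i $ j * x $ j)" for x
        using A(1) unfolding psd_def by blast
      show "cmod (sesq A x y) \<le> 1" if "x \<in> {x. M x \<le> 1}" "y \<in> {y. M y \<le> 1}" for x y
        using sesq_sup_upper [OF M, of x y A] that A(2) by simp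
    qed
  next
    fix A assume "A \<in> ?T"
    then have 1: "A $ i $ j = cnj (A $ j $ i)"
      and 2: "0 \<le> Re (\<Sum>i\<in>UNIV. \<Sum>j\<in>UNIV. cnj (x $ i) * A $ i $ j * x $ j)"
      and 3: "M x \<le> 1 \<Longrightarrow> M y \<le> 1 \<Longrightarrow> cmod (sesq A x y) \<le> 1" for i j x y
      by blast+
    then have "psd A" unfolding psd_def by blast
    moreover have "sesq_sup M A \<le> 1" by (rule sesq_sup_le [OF M 3])
    ultimately show "A \<in> ?S" by blast
  qed
  also have "closed \<dots>"
    by (intro closed_Int closed_INT ballI closed_Collect_eq closed_Collect_le continuous_intros)
  finally have "closed ?S" .
  moreover have "bounded ?S"
    unfolding bounded_iff
  proof (intro exI ballI)
    fix A assume "A \<in> ?S"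
    then have A: "sesq_sup M A \<le> 1" by simp
    have ent: "cmod (A $ i $ j) \<le> M (axis i 1) * M (axis j 1)" for i j
    proof -
      have "sesq_sup M A * (M (axis i 1) * M (axis j 1)) \<le> 1 * (M (axis i 1) * M (axis j 1))"
        using A by (intro mult_right_mono mult_nonneg_nonneg is_norm_nonneg [OF M])
      then show ?thesis using entry_le_sesq_sup [OF M, of A i j] by simp
    qed
    have "norm A \<le> (\<Sum>i\<in>UNIV. norm (A $ i))"
      unfolding norm_vec_def by (rule L2_set_le_sum) simp
    also have "\<dots> \<le> (\<Sum>i\<in>UNIV. \<Sum>j\<in>UNIV. cmod (A $ i $ j))"
      by (intro sum_mono) (subst norm_vec_def, rule L2_set_le_sum, simp)
    also have "\<dots> \<le> (\<Sum>i\<in>UNIV. \<Sum>j\<in>UNIV. M (axis i 1) * M (axis j 1))"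
      by (intro sum_mono ent)
    finally show "norm A \<le> (\<Sum>i\<in>UNIV. \<Sum>j\<in>UNIV. M (axis i 1) * M (axis j 1))" .
  qed
  ultimately show ?thesis by (simp add: compact_eq_bounded_closed)
qed

lemma sesq_sup_eq_0:
  assumes M: "is_norm M" and "sesq_sup M A = 0"
  shows "A = 0"
proof -
  have "A $ i $ j = 0" for i j
    using entry_le_sesq_sup [OF M, of A i j] assms(2) by simp
  then show ?thesis by (simp add: Finite_Cartesian_Product.vec_eq_iff)
qed

lemma pairing_scaleR: "pairing (r *\<^sub>R A) (t *\<^sub>R B) = r * t * pairing A B"
proof -
  have "(\<Sum>i\<in>UNIV. \<Sum>j\<in>UNIV. (r *\<^sub>R A) $ i $ j * (t *\<^sub>R B) $ i $ j)
      = (r * t) *\<^sub>R (\<Sum>i\<in>UNIV. \<Sum>j\<in>UNIV. A $ i $ j * B $ i $ j)"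
    by (simp add: scaleR_right.sum mult.commute [of r])
  then show ?thesis by (simp add: pairing_def del: Re_sum)
qed

text \<open>
  A maximiser of the pairing over the compact set of pairs of injective norm at most 1; by
  homogeneity its value is itself an admissible constant.
\<close>
lemma gamma_const_attained:
  fixes N :: "complex ^ 'm \<Rightarrow> real"
  assumes N: "is_norm N"
  obtains A B where "psd A" "psd B" "sesq_sup (dual_norm N) A \<le> 1" "sesq_sup N B \<le> 1"
    "gamma_const N \<le> pairing A B"
proof -
  note D = is_norm_dual_norm [OF N]
  define S where "S M = {A :: complex ^ 'm ^ 'm. psd A \<and> sesq_sup M A \<le> 1}" for M
  have S0: "0 \<in> S M" if "is_norm M" for M
    using that by (auto simp: S_def psd_def intro!: sesq_sup_le)
  have "\<exists>AB\<in>S (dual_norm N) \<times> S N. \<forall>AB'\<in>S (dual_norm N) \<times> S N.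
      (case AB' of (A, B) \<Rightarrow> pairing A B) \<le> (case AB of (A, B) \<Rightarrow> pairing A B)"
  proof (rule continuous_attains_sup)
    show "compact (S (dual_norm N) \<times> S N)"
      unfolding S_def by (intro compact_Times compact_psd_ball N D)
    show "S (dual_norm N) \<times> S N \<noteq> {}" using S0 [OF N] S0 [OF D] by auto
    show "continuous_on (S (dual_norm N) \<times> S N) (\<lambda>AB. case AB of (A, B) \<Rightarrow> pairing A B)"
      unfolding pairing_def case_prod_unfold by (intro continuous_intros)
  qed
  then obtain A B where AB: "A \<in> S (dual_norm N)" "B \<in> S N"
    and max: "\<And>A' B'. A' \<in> S (dual_norm N) \<Longrightarrow> B' \<in> S N \<Longrightarrow> pairing A' B' \<le> pairing A B"
    by fastforce
  have "admissible N (pairing A B)"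
    unfolding admissible_def
  proof (intro allI impI)
    fix A' B' :: "complex ^ 'm ^ 'm" assume psd: "psd A'" "psd B'"
    define s where "s = sesq_sup (dual_norm N) A'"
    define t where "t = sesq_sup N B'"
    have st: "0 \<le> s" "0 \<le> t" unfolding s_def t_def by (intro sesq_sup_nonneg N D)+
    show "pairing A' B' \<le> pairing A B * sesq_sup (dual_norm N) A' * sesq_sup N B'"
    proof (cases "s = 0 \<or> t = 0")
      case True
      then have "A' = 0 \<or> B' = 0"
        using sesq_sup_eq_0 [OF D, of A'] sesq_sup_eq_0 [OF N, of B'] by (auto simp: s_def t_def)
      then have "pairing A' B' = 0" by (auto simp: pairing_def)
      moreover have "sesq_sup (dual_norm N) A' = 0 \<or> sesq_sup N B' = 0"
        using True by (simp add: s_def t_def)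
      ultimately show ?thesis by auto
    next
      case False
      with st have pos: "0 < s" "0 < t" by auto
      have "(1 / s) *\<^sub>R A' \<in> S (dual_norm N)"
        using sesq_sup_scaleR_le [OF D, of "1 / s" A'] pos psd
        by (auto simp: S_def s_def intro!: psd_scaleR)
      moreover have "(1 / t) *\<^sub>R B' \<in> S N"
        using sesq_sup_scaleR_le [OF N, of "1 / t" B'] pos psd
        by (auto simp: S_def t_def intro!: psd_scaleR)
      ultimately have "pairing ((1 / s) *\<^sub>R A') ((1 / t) *\<^sub>R B') \<le> pairing A B" by (rule max)
      then show ?thesis
        using pos unfolding pairing_scaleR s_def [symmetric] t_def [symmetric]
        by (simp add: field_simps)
    qed
  qed
  then have "gamma_const N \<le> pairing A B" by (rule gamma_const_le [OF N])
  then show ?thesis using AB that by (auto simp: S_def)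
qed

section \<open>Operator norms of matrices\<close>

lemma l2_norm_sq: "(l2_norm v)\<^sup>2 = norm_sq (dim_vec v) (vec_index v)"
  by (simp add: l2_norm_def L2_set_def norm_sq_def sum_nonneg)

lemma l2_norm_nonneg [simp]: "0 \<le> l2_norm v"
  by (simp add: l2_norm_def)

lemma mult_mat_vec_index:
  assumes "A \<in> carrier_mat r c" "v \<in> carrier_vec c" "i < r"
  shows "vec_index (A *\<^sub>v v) i = (\<Sum>j<c. A $$ (i, j) * vec_index v j)"
  using assms by (auto simp: scalar_prod_def atLeast0LessThan intro!: sum.cong)

lemma l2_norm_mult_le:
  assumes A: "A \<in> carrier_mat r c" and v: "v \<in> carrier_vec c"
  shows "l2_norm (A *\<^sub>v v) \<le> (\<Sum>i<r. \<Sum>j<c. cmod (A $$ (i, j))) * l2_norm v"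
proof -
  have "l2_norm (A *\<^sub>v v) \<le> (\<Sum>i<r. cmod (vec_index (A *\<^sub>v v) i))"
    using A unfolding l2_norm_def by (auto intro!: order_trans [OF L2_set_le_sum])
  also have "\<dots> \<le> (\<Sum>i<r. \<Sum>j<c. cmod (A $$ (i, j)) * l2_norm v)"
  proof (intro sum_mono)
    fix i assume "i \<in> {..<r}"
    then have "cmod (vec_index (A *\<^sub>v v) i) \<le> (\<Sum>j<c. cmod (A $$ (i, j) * vec_index v j))"
      by (simp add: mult_mat_vec_index [OF A v] norm_sum del: index_mult_mat_vec)
    also have "\<dots> \<le> (\<Sum>j<c. cmod (A $$ (i, j)) * l2_norm v)"
      unfolding norm_mult l2_norm_def using v
      by (intro sum_mono mult_left_mono) (auto intro!: member_le_L2_set)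
    finally show "cmod (vec_index (A *\<^sub>v v) i) \<le> (\<Sum>j<c. cmod (A $$ (i, j)) * l2_norm v)" .
  qed
  finally show ?thesis by (simp add: sum_distrib_right)
qed

lemma l2_norm_zero_vec [simp]: "l2_norm (0\<^sub>v n) = 0"
  by (simp add: l2_norm_def L2_set_def)

lemma op_norm_le:
  assumes A: "A \<in> carrier_mat r c" and b: "0 \<le> b"
    and le: "\<And>v. v \<in> carrier_vec c \<Longrightarrow> l2_norm (A *\<^sub>v v) \<le> b * l2_norm v"
  shows "op_norm A \<le> b"
  unfolding op_norm_def
proof (rule cSUP_least)
  have "0\<^sub>v (dim_col A) \<in> {v \<in> carrier_vec (dim_col A). l2_norm v \<le> 1}" by simp
  then show "{v \<in> carrier_vec (dim_col A). l2_norm v \<le> 1} \<noteq> {}" by blast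
  fix v assume v: "v \<in> {v \<in> carrier_vec (dim_col A). l2_norm v \<le> 1}"
  then have "l2_norm (A *\<^sub>v v) \<le> b * l2_norm v" using A by (intro le) auto
  also have "\<dots> \<le> b * 1" using v b by (intro mult_left_mono) auto
  finally show "l2_norm (A *\<^sub>v v) \<le> b" by simp
qed

lemma op_norm_le_sum_entries:
  assumes "A \<in> carrier_mat r c"
  shows "op_norm A \<le> (\<Sum>i<r. \<Sum>j<c. cmod (A $$ (i, j)))"
  by (rule op_norm_le [OF assms]) (auto intro!: sum_nonneg l2_norm_mult_le assms)

lemma l2_norm_smult: "l2_norm (c \<cdot>\<^sub>v v) = cmod c * l2_norm v"
proof -
  have "(l2_norm (c \<cdot>\<^sub>v v))\<^sup>2 = (cmod c * l2_norm v)\<^sup>2"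
    unfolding l2_norm_sq power_mult_distrib norm_sq_scale [symmetric]
    by (simp add: norm_sq_def)
  then show ?thesis by simp
qed

lemma op_norm_bdd:
  assumes A: "A \<in> carrier_mat r c"
  shows "bdd_above ((\<lambda>v. l2_norm (A *\<^sub>v v)) ` {v \<in> carrier_vec (dim_col A). l2_norm v \<le> 1})"
proof (rule bdd_aboveI2)
  fix v assume "v \<in> {v \<in> carrier_vec (dim_col A). l2_norm v \<le> 1}"
  then have v: "v \<in> carrier_vec c" "l2_norm v \<le> 1" using A by auto
  show "l2_norm (A *\<^sub>v v) \<le> (\<Sum>i<r. \<Sum>j<c. cmod (A $$ (i, j))) * 1"
    using v(2) by (intro order_trans [OF l2_norm_mult_le [OF A v(1)]] mult_left_mono sum_nonneg) auto
qed

lemma op_norm_nonneg: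
  assumes A: "A \<in> carrier_mat r c"
  shows "0 \<le> op_norm A"
proof -
  have "l2_norm (A *\<^sub>v 0\<^sub>v c) \<le> op_norm A"
    unfolding op_norm_def using A op_norm_bdd [OF A] by (intro cSUP_upper) auto
  then show ?thesis using l2_norm_nonneg order_trans by blast
qed

lemma l2_norm_le_op_norm:
  assumes A: "A \<in> carrier_mat r c" and v: "v \<in> carrier_vec c"
  shows "l2_norm (A *\<^sub>v v) \<le> op_norm A * l2_norm v"
proof (cases "l2_norm v = 0")
  case True
  then show ?thesis using l2_norm_mult_le [OF A v] by simp
next
  case False
  then have pos: "0 < l2_norm v" using l2_norm_nonneg [of v] by linarith
  define u where "u = complex_of_real (1 / l2_norm v) \<cdot>\<^sub>v v"
  have "l2_norm (A *\<^sub>v u) \<le> op_norm A"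
    unfolding op_norm_def using A v pos op_norm_bdd [OF A]
    by (intro cSUP_upper) (auto simp: u_def l2_norm_smult norm_divide)
  also have "A *\<^sub>v u = complex_of_real (1 / l2_norm v) \<cdot>\<^sub>v (A *\<^sub>v v)"
    unfolding u_def by (rule mult_mat_vec [OF A v])
  finally show ?thesis
    using pos by (simp add: l2_norm_smult norm_divide field_simps)
qed

text \<open>
  Apply the matrix to the conjugate of the row.
\<close>
lemma row_norm_le_op_norm:
  assumes A: "A \<in> carrier_mat r c" and i: "i < r"
  shows "sqrt (\<Sum>j<c. (cmod (A $$ (i, j)))\<^sup>2) \<le> op_norm A"
proof (rule le_of_square_le_mult)
  define \<rho> where "\<rho> = sqrt (\<Sum>j<c. (cmod (A $$ (i, j)))\<^sup>2)"
  define v where "v = Matrix.vec c (\<lambda>j. cnj (A $$ (i, j)))"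
  have v: "v \<in> carrier_vec c" by (simp add: v_def)
  have lv: "l2_norm v = \<rho>" by (simp add: l2_norm_def L2_set_def v_def \<rho>_def)
  have "vec_index (A *\<^sub>v v) i = (\<Sum>j<c. A $$ (i, j) * cnj (A $$ (i, j)))"
    unfolding mult_mat_vec_index [OF A v i] by (simp add: v_def)
  also have "\<dots> = of_real (\<rho> * \<rho>)"
    unfolding complex_norm_square [symmetric] by (simp add: \<rho>_def sum_nonneg)
  finally have "cmod (vec_index (A *\<^sub>v v) i) = \<rho> * \<rho>" by (simp add: norm_mult)
  moreover have "cmod (vec_index (A *\<^sub>v v) i) \<le> l2_norm (A *\<^sub>v v)"
    unfolding l2_norm_def using A i by (intro member_le_L2_set) auto
  ultimately show "\<rho> * \<rho> \<le> op_norm A * \<rho>"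
    using l2_norm_le_op_norm [OF A v] by (simp add: lv)
  show "0 \<le> \<rho>" by (simp add: \<rho>_def sum_nonneg)
  show "0 \<le> op_norm A"
    by (rule op_norm_nonneg [OF A])
qed

section \<open>Matrix valued functions on the unit ball\<close>

lemma complex_line_derivative:
  fixes f :: "complex ^ 'm \<Rightarrow> complex"
  assumes D: "(f has_derivative D) (at (t *s z))" "\<And>c w. D (c *s w) = c * D w"
  shows "((\<lambda>t. f (t *s z)) has_field_derivative D z) (at t)"
proof -
  have "((\<lambda>t. t *s z) has_derivative (\<lambda>t. t *s z)) (at t)"
    by (intro bounded_linear_imp_has_derivative linear_conv_bounded_linear [THEN iffD1] linearI)
      (auto simp: Finite_Cartesian_Product.vec_eq_iff algebra_simps)
  then have "((\<lambda>t. f (t *s z)) has_derivative (\<lambda>h. D (h *s z))) (at t)"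
    by (rule has_derivative_compose) (rule D(1))
  then show ?thesis
    unfolding has_field_derivative_def D(2) by (simp only: mult_commute_abs)
qed

lemma H_inf_line_differentiable:
  assumes f: "f \<in> H_inf \<Omega>" and "t *s z \<in> \<Omega>"
  shows "(\<lambda>t. f (t *s z)) field_differentiable (at t)"
proof -
  obtain D where "(f has_derivative D) (at (t *s z))" "\<And>c w. D (c *s w) = c * D w"
    using assms unfolding H_inf_def holomorphic_sev_def by blast
  then show ?thesis
    unfolding field_differentiable_def by (intro exI [of _ "D z"] complex_line_derivative)
qed

lemma H_inf_line_deriv:
  assumes f: "f \<in> H_inf \<Omega>" and "0 \<in> \<Omega>"
  shows "((\<lambda>t. f (t *s z)) has_field_derivative (\<Sum>j\<in>UNIV. z $ j * partial_at_0 j f)) (at 0)"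
proof -
  obtain D where D: "(f has_derivative D) (at 0)" "\<And>c w. D (c *s w) = c * D w"
    using assms unfolding H_inf_def holomorphic_sev_def by blast
  have line: "((\<lambda>t. f (t *s z)) has_field_derivative D z) (at 0)" for z
    by (rule complex_line_derivative) (simp_all add: D)
  have "axis j t = t *s axis j 1" for j :: 'a and t :: complex
    by (simp add: Finite_Cartesian_Product.vec_eq_iff axis_def)
  then have "(\<lambda>t. f (axis j t)) = (\<lambda>t. f (t *s axis j 1))" for j
    by (intro ext arg_cong [where f = f])
  then have partial: "partial_at_0 j f = D (axis j 1)" for j
    unfolding partial_at_0_def by (metis DERIV_imp_deriv line)
  interpret D: bounded_linear D using D(1) by (rule has_derivative_bounded_linear)
  have "D z = D (\<Sum>j\<in>UNIV. z $ j *s axis j 1)" by (simp add: basis_expansion)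
  also have "\<dots> = (\<Sum>j\<in>UNIV. z $ j * partial_at_0 j f)"
    by (simp add: D.sum D(2) partial)
  finally show ?thesis using line [of z] by simp
qed

abbreviation mat_entries :: "complex mat \<Rightarrow> nat \<Rightarrow> nat \<Rightarrow> complex" where
  "mat_entries A \<equiv> \<lambda>i j. A $$ (i, j)"

lemma norm_sq_app_mat_entries:
  assumes "A \<in> carrier_mat k k"
  shows "norm_sq k (app_mat k (mat_entries A) h) = (l2_norm (A *\<^sub>v Matrix.vec k h))\<^sup>2"
  unfolding l2_norm_sq using assms
  by (auto simp: norm_sq_def app_mat_def scalar_prod_def atLeast0LessThan intro!: sum.cong)

lemma H_inf_mat_op_norm_le:
  assumes F: "F \<in> H_inf_mat k \<Omega>" and z: "z \<in> \<Omega>"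
  shows "op_norm (F z) \<le> H_inf_mat_norm \<Omega> F"
  unfolding H_inf_mat_norm_def
proof (rule cSUP_upper [OF z])
  have "\<forall>p<k. \<forall>q<k. \<exists>b. \<forall>z\<in>\<Omega>. cmod (F z $$ (p, q)) \<le> b"
    using F by (auto simp: H_inf_mat_def H_inf_def bounded_iff)
  then obtain b where b: "\<And>p q z. p < k \<Longrightarrow> q < k \<Longrightarrow> z \<in> \<Omega> \<Longrightarrow> cmod (F z $$ (p, q)) \<le> b p q"
    by metis
  show "bdd_above ((\<lambda>z. op_norm (F z)) ` \<Omega>)"
  proof (rule bdd_aboveI2)
    fix z assume z: "z \<in> \<Omega>"
    then have "F z \<in> carrier_mat k k" using F by (simp add: H_inf_mat_def)
    then have "op_norm (F z) \<le> (\<Sum>i<k. \<Sum>j<k. cmod (F z $$ (i, j)))"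
      by (rule op_norm_le_sum_entries)
    also have "\<dots> \<le> (\<Sum>i<k. \<Sum>j<k. b i j)"
      by (intro sum_mono b z) auto
    finally show "op_norm (F z) \<le> (\<Sum>i<k. \<Sum>j<k. b i j)" .
  qed
qed

lemma H_inf_mat_contraction:
  assumes F: "F \<in> H_inf_mat k \<Omega>" "H_inf_mat_norm \<Omega> F \<le> 1" and z: "z \<in> \<Omega>"
  shows "norm_sq k (app_mat k (mat_entries (F z)) h) \<le> norm_sq k h"
proof -
  have Fz: "F z \<in> carrier_mat k k" using F(1) z by (simp add: H_inf_mat_def)
  have "l2_norm (F z *\<^sub>v Matrix.vec k h) \<le> op_norm (F z) * l2_norm (Matrix.vec k h)"
    by (rule l2_norm_le_op_norm [OF Fz]) simp
  also have "\<dots> \<le> 1 * l2_norm (Matrix.vec k h)"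
    using H_inf_mat_op_norm_le [OF F(1) z] F(2) by (intro mult_right_mono) auto
  finally have "(l2_norm (F z *\<^sub>v Matrix.vec k h))\<^sup>2 \<le> (l2_norm (Matrix.vec k h))\<^sup>2"
    by (simp add: power_mono)
  then show ?thesis
    unfolding norm_sq_app_mat_entries [OF Fz] by (simp add: l2_norm_sq norm_sq_def)
qed

text \<open>
  Restrict \<open>F\<close> to the complex line through \<open>z\<close>. If \<open>N z < 1\<close>, the line meets the ball in a
  disc of radius greater than 1, and the inequality on the disc applies; a boundary point is
  approached along its ray.
\<close>
lemma matrix_schwarz_pick_ball:
  assumes N: "is_norm N" and F: "F \<in> H_inf_mat k (unit_ball N)" "H_inf_mat_norm (unit_ball N) F \<le> 1"
    and z: "N z \<le> 1"
  shows "2 * Re (cinner k g (app_mat k (\<lambda>p q. \<Sum>j\<in>UNIV. z $ j * partial_at_0 j (\<lambda>w. F w $$ (p, q))) h))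
      \<le> defect k (conj_transp (mat_entries (F 0))) g + defect k (mat_entries (F 0)) h"
proof -
  define Y where "Y z p q = (\<Sum>j\<in>UNIV. z $ j * partial_at_0 j (\<lambda>w. F w $$ (p, q)))" for z p q
  have entry: "(\<lambda>w. F w $$ (p, q)) \<in> H_inf (unit_ball N)" if "p < k" "q < k" for p q
    using F(1) that by (simp add: H_inf_mat_def)
  have 0: "0 \<in> unit_ball N" by (simp add: unit_ball_def is_norm_0 [OF N])
  have inside: "2 * Re (cinner k g (app_mat k (Y z) h))
      \<le> defect k (conj_transp (mat_entries (F 0))) g + defect k (mat_entries (F 0)) h" if z: "N z < 1" for z
  proof -
    (* any R with 1 < R and R * N z < 1, uniformly also for N z = 0 *)
    define R where "R = 2 / (1 + N z)"
    have Nz: "0 \<le> N z" by (rule is_norm_nonneg [OF N])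
    have R: "1 < R" using z Nz by (simp add: R_def field_simps)
    have in_ball: "t *s z \<in> unit_ball N" if "t \<in> ball 0 R" for t
    proof -
      have "N (t *s z) \<le> R * N z"
        unfolding is_norm_scale [OF N] using that Nz by (intro mult_right_mono) auto
      also have "\<dots> < 1" using z Nz by (simp add: R_def field_simps)
      finally show ?thesis by (simp add: unit_ball_def)
    qed
    have "2 * Re (cinner k g (app_mat k (Y z) h))
        \<le> (norm_sq k g - norm_sq k (app_mat k (conj_transp (mat_entries (F (0 *s z)))) g)) + (norm_sq k h - norm_sq k (app_mat k (mat_entries (F (0 *s z))) h))"
    proof (rule matrix_schwarz_pick_disc [OF R, where G = "\<lambda>t. mat_entries (F (t *s z))"])
      fix p q assume pq: "p < k" "q < k"
      show "(\<lambda>t. F (t *s z) $$ (p, q)) holomorphic_on ball 0 R"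
        unfolding holomorphic_on_def
        by (rule ballI, rule field_differentiable_at_within, rule H_inf_line_differentiable [OF entry [OF pq]],
            rule in_ball)
      show "((\<lambda>t. F (t *s z) $$ (p, q)) has_field_derivative Y z p q) (at 0)"
        unfolding Y_def by (rule H_inf_line_deriv [OF entry [OF pq] 0])
    next
      fix t :: complex and h assume "cmod t \<le> 1"
      then show "norm_sq k (app_mat k (mat_entries (F (t *s z))) h) \<le> norm_sq k h"
        using R by (intro H_inf_mat_contraction [OF F] in_ball) auto
    qed
    then show ?thesis by (simp add: defect_def)
  qed
  have "2 * Re (cinner k g (app_mat k (Y z) h)) \<le> defect k (conj_transp (mat_entries (F 0))) g + defect k (mat_entries (F 0)) h"
  proof (rule field_le_mult_one_interval)
    fix r :: real assume r: "0 < r" "r < 1"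
    have "N (r *\<^sub>R z) \<le> r * 1"
      unfolding is_norm_scaleR [OF N] using r z by (intro mult_mono) (auto simp: is_norm_nonneg [OF N])
    then have "N (r *\<^sub>R z) < 1" using r by simp
    moreover have "Y (r *\<^sub>R z) = (\<lambda>p q. of_real r * Y z p q)"
      unfolding Y_def scaleR_vec_nth by (simp add: sum_distrib_left mult.assoc)
    then have "app_mat k (Y (r *\<^sub>R z)) h = (\<lambda>p. of_real r * app_mat k (Y z) h p)"
      by (simp add: app_mat_def sum_distrib_left mult.assoc)
    then have "Re (cinner k g (app_mat k (Y (r *\<^sub>R z)) h)) = r * Re (cinner k g (app_mat k (Y z) h))"
      by (simp add: cinner_scale_right)
    ultimately show "r * (2 * Re (cinner k g (app_mat k (Y z) h)))
        \<le> defect k (conj_transp (mat_entries (F 0))) g + defect k (mat_entries (F 0)) h"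
      using inside [of "r *\<^sub>R z"] by simp
  qed
  then show ?thesis unfolding Y_def .
qed

section \<open>Upper bounds for little Parrott homomorphisms\<close>

lemma sum_lessThan_mult:
  fixes f :: "nat \<Rightarrow> 'b::comm_monoid_add"
  shows "(\<Sum>i<n * k. f i) = (\<Sum>b<n. \<Sum>q<k. f (b * k + q))"
  by (simp add: sum.nat_group [symmetric] sum.atLeastLessThan_shift_0 atLeast0LessThan)

lemma little_parrott_carrier: "little_parrott n V f \<in> carrier_mat (n + 1) (n + 1)"
  by (auto simp: little_parrott_def Df0_dot_def)

lemma little_parrott_entry:
  shows "little_parrott n V f $$ (0, 0) = f 0"
    and "l < n \<Longrightarrow> little_parrott n V f $$ (0, Suc l) = (\<Sum>j\<in>UNIV. partial_at_0 j f * V j $$ (0, l))"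
    and "l < n \<Longrightarrow> little_parrott n V f $$ (Suc l, 0) = 0"
    and "l < n \<Longrightarrow> l' < n \<Longrightarrow> little_parrott n V f $$ (Suc l, Suc l') = (if l = l' then f 0 else 0)"
  by (auto simp: little_parrott_def Df0_dot_def)

lemma little_parrott_amp_carrier: "little_parrott_amp n V k F \<in> carrier_mat ((n + 1) * k) ((n + 1) * k)"
  by (simp add: little_parrott_amp_def)

lemma block_index_less: "b < m \<Longrightarrow> p < k \<Longrightarrow> b * k + p < m * (k::nat)"
  using mult_le_mono1 [of "Suc b" m k] by simp

lemma little_parrott_amp_entry:
  assumes "b < n + 1" "d < n + 1" "p < k" "q < k"
  shows "little_parrott_amp n V k F $$ (b * k + p, d * k + q)
      = little_parrott n V (\<lambda>z. F z $$ (p, q)) $$ (b, d)"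
  using assms block_index_less [of b "n + 1" p k] block_index_less [of d "n + 1" q k]
  by (simp add: little_parrott_amp_def)

abbreviation row_entries :: "('m \<Rightarrow> complex mat) \<Rightarrow> 'm \<Rightarrow> nat \<Rightarrow> complex" where
  "row_entries V \<equiv> \<lambda>j l. V j $$ (0, l)"

text \<open>
  Reads the matrix \<open>little_parrott_amp n V k F\<close> as a block operator on
  \<open>1 + n\<close> vectors of size \<open>k\<close>: \<open>a\<close> and \<open>h\<^sub>l\<close> are the blocks of \<open>v\<close>, \<open>W\<close> is the value and
  \<open>Y\<^sub>j\<close> are the partial derivatives of \<open>F\<close> at 0.
\<close>
lemma amp_op_norm_le_if_derivative_block_bound:
  fixes V :: "'m::finite \<Rightarrow> complex mat" and F :: "complex ^ 'm \<Rightarrow> complex mat"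
  defines "W \<equiv> mat_entries (F 0)" and "Y \<equiv> \<lambda>j p q. partial_at_0 j (\<lambda>z. F z $$ (p, q))"
  assumes con: "\<And>h. norm_sq k (app_mat k W h) \<le> norm_sq k h"
    and mid: "\<And>g h. Re (\<Sum>l<n. cinner k g (\<lambda>p. \<Sum>j\<in>UNIV. row_entries V j l * app_mat k (Y j) (h l) p))
        \<le> sqrt c * sqrt (defect k (conj_transp W) g) * sqrt (\<Sum>l<n. defect k W (h l))"
    and c: "1 \<le> c"
  shows "op_norm (little_parrott_amp n V k F) \<le> sqrt c"
proof (rule op_norm_le [OF little_parrott_amp_carrier])
  let ?M = "little_parrott_amp n V k F"
  show "0 \<le> sqrt c" using c by simp
  fix v :: "complex Matrix.vec" assume v: "v \<in> carrier_vec ((n + 1) * k)"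
  define a where "a = (\<lambda>p. vec_index v p)"
  define h where "h = (\<lambda>l p. vec_index v (Suc l * k + p))"
  define X where "X l = (\<lambda>p. \<Sum>j\<in>UNIV. row_entries V j l * app_mat k (Y j) (h l) p)" for l
  have Mv: "vec_index (?M *\<^sub>v v) (b * k + p)
      = (\<Sum>d<n + 1. \<Sum>q<k. little_parrott n V (\<lambda>z. F z $$ (p, q)) $$ (b, d) * vec_index v (d * k + q))"
    if b: "b < n + 1" and p: "p < k" for b p
  proof -
    have "vec_index (?M *\<^sub>v v) (b * k + p)
        = (\<Sum>j<(n + 1) * k. ?M $$ (b * k + p, j) * vec_index v j)"
      by (rule mult_mat_vec_index [OF little_parrott_amp_carrier v block_index_less [OF b p]])
    also have "\<dots> = (\<Sum>d<n + 1. \<Sum>q<k. ?M $$ (b * k + p, d * k + q) * vec_index v (d * k + q))"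
      by (rule sum_lessThan_mult)
    also have "\<dots> = (\<Sum>d<n + 1. \<Sum>q<k. little_parrott n V (\<lambda>z. F z $$ (p, q)) $$ (b, d) * vec_index v (d * k + q))"
      using b p by (intro sum.cong refl) (simp add: little_parrott_amp_entry)
    finally show ?thesis .
  qed
  have top: "vec_index (?M *\<^sub>v v) (0 * k + p) = app_mat k W a p + (\<Sum>l<n. X l p)" if p: "p < k" for p
  proof -
    have "(\<Sum>q<k. little_parrott n V (\<lambda>z. F z $$ (p, q)) $$ (0, Suc l) * vec_index v (Suc l * k + q)) = X l p"
      if l: "l < n" for l
    proof -
      have "(\<Sum>q<k. little_parrott n V (\<lambda>z. F z $$ (p, q)) $$ (0, Suc l) * vec_index v (Suc l * k + q))
          = (\<Sum>q<k. \<Sum>j\<in>UNIV. V j $$ (0, l) * (Y j p q * h l q))"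
        by (intro sum.cong refl)
          (simp add: little_parrott_entry(2) [OF l] Y_def h_def sum_distrib_right mult.assoc mult.left_commute)
      also have "\<dots> = (\<Sum>j\<in>UNIV. \<Sum>q<k. V j $$ (0, l) * (Y j p q * h l q))" by (rule sum.swap)
      also have "\<dots> = X l p" by (simp add: X_def app_mat_def sum_distrib_left)
      finally show ?thesis .
    qed
    moreover have "(\<Sum>q<k. little_parrott n V (\<lambda>z. F z $$ (p, q)) $$ (0, 0) * vec_index v (0 * k + q)) = app_mat k W a p"
      by (simp add: little_parrott_entry app_mat_def W_def a_def)
    moreover have zn: "0 < n + 1" by simp
    ultimately show ?thesis
      unfolding Mv [OF zn p]
      unfolding Suc_eq_plus1 [symmetric] sum.lessThan_Suc_shift by simp
  qed
  have rest: "vec_index (?M *\<^sub>v v) (Suc l * k + p) = app_mat k W (h l) p" if l: "l < n" and p: "p < k" for l p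
  proof -
    have "(\<Sum>q<k. little_parrott n V (\<lambda>z. F z $$ (p, q)) $$ (Suc l, Suc l') * vec_index v (Suc l' * k + q))
        = (if l' = l then app_mat k W (h l) p else 0)" if l': "l' < n" for l'
      using l l' by (auto simp: little_parrott_entry(4) app_mat_def W_def h_def)
    then have "(\<Sum>l'<n. \<Sum>q<k. little_parrott n V (\<lambda>z. F z $$ (p, q)) $$ (Suc l, Suc l') * vec_index v (Suc l' * k + q))
        = (\<Sum>l'<n. if l' = l then app_mat k W (h l) p else 0)"
      by (intro sum.cong) auto
    moreover have "(\<Sum>q<k. little_parrott n V (\<lambda>z. F z $$ (p, q)) $$ (Suc l, 0) * vec_index v (0 * k + q)) = 0"
      using l by (simp add: little_parrott_entry)
    moreover have sl: "Suc l < n + 1" using l by simp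
    ultimately show ?thesis
      using l unfolding Mv [OF sl p]
      unfolding Suc_eq_plus1 [symmetric] sum.lessThan_Suc_shift by simp
  qed
  have split: "norm_sq ((n + 1) * k) u = norm_sq k (\<lambda>p. u (0 * k + p)) + (\<Sum>l<n. norm_sq k (\<lambda>p. u (Suc l * k + p)))" for u
    unfolding norm_sq_def sum_lessThan_mult unfolding Suc_eq_plus1 [symmetric] sum.lessThan_Suc_shift ..
  have "(l2_norm (?M *\<^sub>v v))\<^sup>2 = norm_sq ((n + 1) * k) (vec_index (?M *\<^sub>v v))"
    unfolding l2_norm_sq by (simp add: little_parrott_amp_def)
  also have "\<dots> = norm_sq k (\<lambda>p. app_mat k W a p + (\<Sum>l<n. X l p)) + (\<Sum>l<n. norm_sq k (app_mat k W (h l)))"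
    unfolding split
    by (intro arg_cong2 [where f = "(+)"] sum.cong refl norm_sq_cong top rest) auto
  also have "\<dots> \<le> c * (norm_sq k a + (\<Sum>l<n. norm_sq k (h l)))"
    by (rule block_operator_bound [OF con _ c]) (unfold X_def, rule mid)
  also have "norm_sq k a + (\<Sum>l<n. norm_sq k (h l)) = norm_sq ((n + 1) * k) (vec_index v)"
    unfolding split a_def h_def by simp
  also have "\<dots> = (l2_norm v)\<^sup>2" using v by (simp add: l2_norm_sq)
  finally have "(l2_norm (?M *\<^sub>v v))\<^sup>2 \<le> (sqrt c * l2_norm v)\<^sup>2"
    using c by (simp add: power_mult_distrib)
  then show "l2_norm (?M *\<^sub>v v) \<le> sqrt c * l2_norm v"
    by (rule power2_le_imp_le) (use c in simp)
qed

lemma norm_sq_lin_comb_le: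
  assumes M: "is_norm M"
  shows "norm_sq n (lin_comb v x) \<le> sesq_sup M (gram n v) * (M x)\<^sup>2"
proof (cases "M x = 0")
  case True
  then have "x = 0" by (rule is_norm_eq_0 [OF M])
  then show ?thesis by (simp add: norm_sq_def lin_comb_def is_norm_0 [OF M])
next
  case False
  then have pos: "0 < M x" using is_norm_nonneg [OF M, of x] by simp
  have "norm_sq n (lin_comb v ((1 / M x) *\<^sub>R x)) \<le> sesq_sup M (gram n v)"
    using pos by (intro norm_sq_lin_comb_le_on_ball [OF M]) (simp add: is_norm_scaleR [OF M])
  also have "lin_comb v ((1 / M x) *\<^sub>R x) = (\<lambda>a. of_real (1 / M x) * lin_comb v x a)"
    unfolding lin_comb_def sum_distrib_left scaleR_vec_nth by (simp add: mult.assoc)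
  also have "norm_sq n \<dots> = norm_sq n (lin_comb v x) / (M x)\<^sup>2"
    unfolding norm_sq_scale by (simp add: norm_divide power_divide)
  finally show ?thesis using pos by (simp add: field_simps)
qed

lemma amp_op_norm_le_sqrt_gamma_const:
  fixes V :: "'m::finite \<Rightarrow> complex mat" and N :: "complex ^ 'm \<Rightarrow> real"
  assumes N: "is_norm N" and F: "F \<in> H_inf_mat k (unit_ball N)" "H_inf_mat_norm (unit_ball N) F \<le> 1"
    and V: "sesq_sup (dual_norm N) (gram n (row_entries V)) \<le> 1"
  shows "op_norm (little_parrott_amp n V k F) \<le> sqrt (gamma_const N)"
proof (rule amp_op_norm_le_if_derivative_block_bound)
  have 0: "0 \<in> unit_ball N" by (simp add: unit_ball_def is_norm_0 [OF N])
  show con: "norm_sq k (app_mat k (mat_entries (F 0)) h) \<le> norm_sq k h" for h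
    by (rule H_inf_mat_contraction [OF F 0])
  show g1: "1 \<le> gamma_const N" by (rule gamma_const_ge_1 [OF N])
  fix g h
  show "Re (\<Sum>l<n. cinner k g (\<lambda>p. \<Sum>j\<in>UNIV. row_entries V j l * app_mat k (\<lambda>p q. partial_at_0 j (\<lambda>z. F z $$ (p, q))) (h l) p))
      \<le> sqrt (gamma_const N) * sqrt (defect k (conj_transp (mat_entries (F 0))) g) * sqrt (\<Sum>l<n. defect k (mat_entries (F 0)) (h l))"
  proof (rule derivative_block_bound [where N = N])
    show "N 0 = 0" by (rule is_norm_0 [OF N])
    show "0 \<le> gamma_const N" using g1 by simp
    show "2 * Re (cinner k g (app_mat k (\<lambda>p q. \<Sum>j\<in>UNIV. z $ j * partial_at_0 j (\<lambda>z. F z $$ (p, q))) h))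
        \<le> defect k (conj_transp (mat_entries (F 0))) g + defect k (mat_entries (F 0)) h" if "N z \<le> 1" for z g h
      by (rule matrix_schwarz_pick_ball [OF N F that])
    fix B :: "complex ^ 'm ^ 'm" assume B: "psd B"
    have "pairing (gram n (row_entries V)) B
        \<le> gamma_const N * sesq_sup (dual_norm N) (gram n (row_entries V)) * sesq_sup N B"
      using admissible_gamma_const [OF N] B psd_gram unfolding admissible_def by blast
    also have "\<dots> \<le> gamma_const N * 1 * sesq_sup N B"
      using V g1 by (intro mult_right_mono mult_left_mono sesq_sup_nonneg N) auto
    finally show "Re (\<Sum>i\<in>UNIV. \<Sum>j\<in>UNIV. (\<Sum>l<n. row_entries V i l * cnj (row_entries V j l)) * B $ i $ j)
        \<le> gamma_const N * sesq_sup N B"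
      by (simp add: pairing_def gram_def)
  qed (rule con)
qed

text \<open>
  For scalar functions the constant \<open>\<gamma>\<close> is replaced by 1. Here both defect
  forms are the squared modulus times \<open>\<delta> = 1 - \<bar>w\<bar>\<^sup>2\<close>, with \<open>w\<close> the value at 0, and the Schwarz-Pick inequality says
  that the gradient \<open>y\<close> has dual norm at most \<open>\<delta>\<close>.
\<close>
lemma amp_1_op_norm_le_1:
  fixes V :: "'m::finite \<Rightarrow> complex mat" and N :: "complex ^ 'm \<Rightarrow> real"
  assumes N: "is_norm N" and F: "F \<in> H_inf_mat 1 (unit_ball N)" "H_inf_mat_norm (unit_ball N) F \<le> 1"
    and V: "sesq_sup (dual_norm N) (gram n (row_entries V)) \<le> 1"
  shows "op_norm (little_parrott_amp n V 1 F) \<le> 1"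
proof (rule amp_op_norm_le_if_derivative_block_bound [where c = 1, unfolded real_sqrt_one mult_1_left])
  note D = is_norm_dual_norm [OF N]
  define w where "w = F 0 $$ (0, 0)"
  define \<delta> where "\<delta> = 1 - (cmod w)\<^sup>2"
  define y :: "complex ^ 'm" where "y = (\<chi> j. partial_at_0 j (\<lambda>z. F z $$ (0, 0)))"
  have 0: "0 \<in> unit_ball N" by (simp add: unit_ball_def is_norm_0 [OF N])
  show con: "norm_sq 1 (app_mat 1 (mat_entries (F 0)) h) \<le> norm_sq 1 h" for h
    by (rule H_inf_mat_contraction [OF F 0])
  have def1: "defect 1 (mat_entries (F 0)) h = \<delta> * (cmod (h 0))\<^sup>2"
    and def2: "defect 1 (conj_transp (mat_entries (F 0))) h = \<delta> * (cmod (h 0))\<^sup>2" for h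
    by (simp_all add: defect_def norm_sq_def app_mat_def conj_transp_def \<delta>_def w_def norm_mult power_mult_distrib algebra_simps)
  have \<delta>: "0 \<le> \<delta>" using defect_nonneg [OF con, of "\<lambda>_. 1"] def1 [of "\<lambda>_. 1"] by simp
  have "dual_norm N y \<le> \<delta>"
  proof (rule dual_norm_le [OF N])
    fix z assume z: "N z \<le> 1"
    define u where "u = (\<Sum>j\<in>UNIV. y $ j * z $ j)"
    show "cmod u \<le> \<delta>"
    proof (cases "u = 0")
      case False
      define g where "g = (\<lambda>_ :: nat. u / of_real (cmod u))"
      have g1: "cmod (g 0) = 1" using False by (simp add: g_def norm_divide)
      have "cinner 1 g (app_mat 1 (\<lambda>p q. \<Sum>j\<in>UNIV. z $ j * partial_at_0 j (\<lambda>w. F w $$ (p, q))) (\<lambda>_. 1)) = cnj (g 0) * u"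
        by (simp add: cinner_def app_mat_def u_def y_def mult.commute)
      also have "\<dots> = (u * cnj u) / of_real (cmod u)" by (simp add: g_def mult.commute)
      also have "\<dots> = of_real (cmod u * cmod u / cmod u)"
        unfolding complex_norm_square [symmetric] by (simp add: power2_eq_square)
      finally have "Re (cinner 1 g (app_mat 1 (\<lambda>p q. \<Sum>j\<in>UNIV. z $ j * partial_at_0 j (\<lambda>w. F w $$ (p, q))) (\<lambda>_. 1))) = cmod u"
        using False by simp
      with matrix_schwarz_pick_ball [OF N F z, of g "\<lambda>_. 1"] show ?thesis
        unfolding def1 def2 g1 by simp
    qed (simp add: \<delta>)
  qed
  then have "(dual_norm N y)\<^sup>2 \<le> \<delta>\<^sup>2"
    by (intro power_mono is_norm_nonneg [OF D])
  then have "sesq_sup (dual_norm N) (gram n (row_entries V)) * (dual_norm N y)\<^sup>2 \<le> 1 * \<delta>\<^sup>2"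
    using V by (intro mult_mono) auto
  with norm_sq_lin_comb_le [OF D, of n "row_entries V" y]
  have lin_comb: "norm_sq n (lin_comb (row_entries V) y) \<le> \<delta>\<^sup>2" by simp
  fix g h
  have "Re (\<Sum>l<n. cinner 1 g (\<lambda>p. \<Sum>j\<in>UNIV. row_entries V j l * app_mat 1 (\<lambda>p q. partial_at_0 j (\<lambda>z. F z $$ (p, q))) (h l) p))
      = Re (cinner n (\<lambda>l. g 0 * cnj (h l 0)) (lin_comb (row_entries V) y))"
    by (rule arg_cong [where f = Re]) (simp add: cinner_def app_mat_def lin_comb_def y_def sum_distrib_left mult_ac)
  also have "\<dots> \<le> cmod (cinner n (\<lambda>l. g 0 * cnj (h l 0)) (lin_comb (row_entries V) y))" by (rule complex_Re_le_cmod)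
  also have "\<dots> \<le> sqrt (norm_sq n (\<lambda>l. g 0 * cnj (h l 0))) * sqrt (norm_sq n (lin_comb (row_entries V) y))" by (rule cmod_cinner_le)
  also have "\<dots> \<le> sqrt (norm_sq n (\<lambda>l. g 0 * cnj (h l 0))) * sqrt (\<delta>\<^sup>2)"
    using lin_comb by (intro mult_left_mono real_sqrt_le_mono) auto
  also have "norm_sq n (\<lambda>l. g 0 * cnj (h l 0)) = (cmod (g 0))\<^sup>2 * (\<Sum>l<n. (cmod (h l 0))\<^sup>2)"
    unfolding norm_sq_scale by (simp add: norm_sq_def)
  also have "sqrt \<dots> * sqrt (\<delta>\<^sup>2) = sqrt (\<delta> * (cmod (g 0))\<^sup>2) * sqrt (\<Sum>l<n. \<delta> * (cmod (h l 0))\<^sup>2)"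
    using \<delta> by (simp add: real_sqrt_mult sum_distrib_left [symmetric])
  finally show "Re (\<Sum>l<n. cinner 1 g (\<lambda>p. \<Sum>j\<in>UNIV. row_entries V j l * app_mat 1 (\<lambda>p q. partial_at_0 j (\<lambda>z. F z $$ (p, q))) (h l) p))
      \<le> sqrt (defect 1 (conj_transp (mat_entries (F 0))) g) * sqrt (\<Sum>l<n. defect 1 (mat_entries (F 0)) (h l))"
    unfolding def1 def2 .
qed simp

section \<open>Contractivity and sharpness\<close>

text \<open>
  The norm of a row is at most the operator norm; this is the first row of the amplified
  matrix, up to its leading \<open>k\<close> entries.
\<close>
lemma derivative_row_le_amp_op_norm:
  fixes V :: "'m::finite \<Rightarrow> complex mat"
  assumes k: "0 < k"
  shows "(\<Sum>l<n. norm_sq k (\<lambda>q. \<Sum>j\<in>UNIV. partial_at_0 j (\<lambda>z. F z $$ (0, q)) * V j $$ (0, l)))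
    \<le> (op_norm (little_parrott_amp n V k F))\<^sup>2"
proof -
  let ?M = "little_parrott_amp n V k F"
  have e: "?M $$ (0, Suc l * k + q) = (\<Sum>j\<in>UNIV. partial_at_0 j (\<lambda>z. F z $$ (0, q)) * V j $$ (0, l))"
    if "l < n" "q < k" for l q
    using little_parrott_amp_entry [of 0 n "Suc l" 0 k q V F] that k
    by (simp add: little_parrott_entry)
  have "(\<Sum>l<n. norm_sq k (\<lambda>q. \<Sum>j\<in>UNIV. partial_at_0 j (\<lambda>z. F z $$ (0, q)) * V j $$ (0, l)))
      = (\<Sum>l<n. \<Sum>q<k. (cmod (?M $$ (0, Suc l * k + q)))\<^sup>2)"
    unfolding norm_sq_def by (intro sum.cong refl) (simp only: e lessThan_iff)
  also have "\<dots> \<le> (\<Sum>b<n + 1. \<Sum>q<k. (cmod (?M $$ (0, b * k + q)))\<^sup>2)"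
    unfolding Suc_eq_plus1 [symmetric] sum.lessThan_Suc_shift by (simp add: sum_nonneg)
  also have "\<dots> = (\<Sum>j<(n + 1) * k. (cmod (?M $$ (0, j)))\<^sup>2)"
    by (rule sum_lessThan_mult [symmetric])
  also have "\<dots> = (sqrt (\<Sum>j<(n + 1) * k. (cmod (?M $$ (0, j)))\<^sup>2))\<^sup>2"
    by (simp add: sum_nonneg)
  also have "\<dots> \<le> (op_norm ?M)\<^sup>2"
    using row_norm_le_op_norm [OF little_parrott_amp_carrier, of 0 n k V F] k
    by (intro power_mono) (auto simp: sum_nonneg)
  finally show ?thesis .
qed

lemma linear_H_inf:
  fixes x :: "complex ^ 'm" and N :: "complex ^ 'm \<Rightarrow> real"
  assumes N: "is_norm N"
  shows "(\<lambda>z. \<Sum>j\<in>UNIV. x $ j * z $ j) \<in> H_inf (unit_ball N)"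
    and "partial_at_0 j (\<lambda>z. \<Sum>j\<in>UNIV. x $ j * z $ j) = x $ j"
proof -
  have lin: "bounded_linear (\<lambda>z :: complex ^ 'm. \<Sum>j\<in>UNIV. x $ j * z $ j)"
    by (intro linear_conv_bounded_linear [THEN iffD1] linearI)
      (auto simp: ring_distribs sum.distrib scaleR_right.sum)
  have "((\<lambda>z. \<Sum>j\<in>UNIV. x $ j * z $ j) has_derivative (\<lambda>z. \<Sum>j\<in>UNIV. x $ j * z $ j)) (at z)" for z
    using lin by (rule bounded_linear_imp_has_derivative)
  moreover have "(\<Sum>j\<in>UNIV. x $ j * (c *s w) $ j) = c * (\<Sum>j\<in>UNIV. x $ j * w $ j)" for c w
    by (simp add: sum_distrib_left mult_ac)
  ultimately have "holomorphic_sev (\<lambda>z. \<Sum>j\<in>UNIV. x $ j * z $ j) (unit_ball N)"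
    unfolding holomorphic_sev_def by blast
  moreover have "bounded ((\<lambda>z. \<Sum>j\<in>UNIV. x $ j * z $ j) ` unit_ball N)"
    unfolding bounded_iff
    by (rule exI [of _ "dual_norm N x"]) (auto simp: unit_ball_def intro!: dual_norm_upper1 [OF N])
  ultimately show "(\<lambda>z. \<Sum>j\<in>UNIV. x $ j * z $ j) \<in> H_inf (unit_ball N)"
    by (simp add: H_inf_def)
  have "(\<lambda>t. \<Sum>i\<in>UNIV. x $ i * axis j t $ i) = (\<lambda>t. x $ j * t)"
    by (simp add: axis_def if_distrib cong: if_cong)
  then show "partial_at_0 j (\<lambda>z. \<Sum>j\<in>UNIV. x $ j * z $ j) = x $ j"
    unfolding partial_at_0_def by simp
qed

lemma little_parrott_amp_1:
  "little_parrott_amp n V 1 (\<lambda>z. Matrix.mat 1 1 (\<lambda>_. f z)) = little_parrott n V f"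
  using little_parrott_carrier [of n V f] by (intro eq_matI) (auto simp: little_parrott_amp_def)

lemma H_inf_mat_of_H_inf:
  fixes N :: "complex ^ 'm \<Rightarrow> real"
  assumes N: "is_norm N" and f: "f \<in> H_inf (unit_ball N)" "H_inf_norm (unit_ball N) f \<le> 1"
  shows "(\<lambda>z. Matrix.mat 1 1 (\<lambda>_. f z)) \<in> H_inf_mat 1 (unit_ball N)"
    and "H_inf_mat_norm (unit_ball N) (\<lambda>z. Matrix.mat 1 1 (\<lambda>_. f z)) \<le> 1"
proof -
  show "(\<lambda>z. Matrix.mat 1 1 (\<lambda>_. f z)) \<in> H_inf_mat 1 (unit_ball N)"
    using f(1) by (simp add: H_inf_mat_def)
  have 0: "0 \<in> unit_ball N" by (simp add: unit_ball_def is_norm_0 [OF N])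
  show "H_inf_mat_norm (unit_ball N) (\<lambda>z. Matrix.mat 1 1 (\<lambda>_. f z)) \<le> 1"
    unfolding H_inf_mat_norm_def
  proof (rule cSUP_least)
    fix z assume z: "z \<in> unit_ball N"
    have "op_norm (Matrix.mat 1 1 (\<lambda>_. f z)) \<le> cmod (f z)"
      using op_norm_le_sum_entries [of "Matrix.mat 1 1 (\<lambda>_. f z)" 1 1] by simp
    also have "\<dots> \<le> H_inf_norm (unit_ball N) f"
    proof -
      obtain b where "\<forall>z\<in>unit_ball N. cmod (f z) \<le> b"
        using f(1) by (auto simp: H_inf_def bounded_iff)
      then have "bdd_above ((\<lambda>z. cmod (f z)) ` unit_ball N)"
        by (intro bdd_aboveI2) auto
      then show ?thesis unfolding H_inf_norm_def by (rule cSUP_upper [OF z])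
    qed
    finally show "op_norm (Matrix.mat 1 1 (\<lambda>_. f z)) \<le> 1" using f(2) by simp
  qed (use 0 in blast)
qed

text \<open>
  Test with linear functions for one direction; for the other, regard a scalar function as a
  \<open>1 \<times> 1\<close> matrix valued one.
\<close>
lemma contractive_iff:
  fixes N :: "complex ^ 'm \<Rightarrow> real" and V :: "'m \<Rightarrow> complex mat"
  assumes N: "is_norm N"
  shows "contractive (unit_ball N) n V \<longleftrightarrow> sesq_sup (dual_norm N) (gram n (row_entries V)) \<le> 1"
proof
  assume V: "contractive (unit_ball N) n V"
  show "sesq_sup (dual_norm N) (gram n (row_entries V)) \<le> 1"
  proof (rule sesq_sup_gram_le [OF is_norm_dual_norm [OF N]])
    fix x :: "complex ^ 'm" assume x: "dual_norm N x \<le> 1"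
    define f where "f = (\<lambda>z :: complex ^ 'm. \<Sum>j\<in>UNIV. x $ j * z $ j)"
    have f: "f \<in> H_inf (unit_ball N)" unfolding f_def by (rule linear_H_inf [OF N])
    have "H_inf_norm (unit_ball N) f \<le> 1"
      unfolding H_inf_norm_def
    proof (rule cSUP_least)
      show "unit_ball N \<noteq> {}" using is_norm_0 [OF N] by (auto simp: unit_ball_def intro!: exI [of _ 0])
      fix z assume "z \<in> unit_ball N"
      then have "cmod (f z) \<le> dual_norm N x"
        unfolding f_def by (intro dual_norm_upper1 [OF N]) (simp add: unit_ball_def)
      with x show "cmod (f z) \<le> 1" by simp
    qed
    with f V have "op_norm (little_parrott n V f) \<le> 1"
      unfolding contractive_def little_parrott_norm_def SUP_le_iff by auto
    then have op1: "op_norm (little_parrott_amp n V 1 (\<lambda>z. Matrix.mat 1 1 (\<lambda>_. f z))) \<le> 1"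
      by (simp only: little_parrott_amp_1)
    have "norm_sq n (lin_comb (row_entries V) x)
        = (\<Sum>l<n. norm_sq 1 (\<lambda>q. \<Sum>j\<in>UNIV. partial_at_0 j (\<lambda>z. Matrix.mat 1 1 (\<lambda>_. f z) $$ (0, q)) * V j $$ (0, l)))"
      by (simp add: norm_sq_def lin_comb_def f_def linear_H_inf(2) [OF N])
    also have "\<dots> \<le> (op_norm (little_parrott_amp n V 1 (\<lambda>z. Matrix.mat 1 1 (\<lambda>_. f z))))\<^sup>2"
      by (rule derivative_row_le_amp_op_norm) simp
    also have "\<dots> \<le> 1"
      using op1 op_norm_nonneg [OF little_parrott_amp_carrier] by (intro power_le_one)
    finally show "norm_sq n (lin_comb (row_entries V) x) \<le> 1" .
  qed
next
  assume V: "sesq_sup (dual_norm N) (gram n (row_entries V)) \<le> 1"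
  have "op_norm (little_parrott n V f) \<le> 1"
    if "f \<in> H_inf (unit_ball N)" "H_inf_norm (unit_ball N) f \<le> 1" for f
    using amp_1_op_norm_le_1 [OF N H_inf_mat_of_H_inf [OF N that] V] by (simp only: little_parrott_amp_1)
  then show "contractive (unit_ball N) n V"
    unfolding contractive_def little_parrott_norm_def SUP_le_iff by auto
qed

lemma sum_norm_sq_eq_pairing:
  "(\<Sum>l<n. norm_sq k (\<lambda>q. \<Sum>j\<in>UNIV. b j q * v j l)) = pairing (gram n v) (gram k b)"
proof -
  have "complex_of_real (\<Sum>l<n. norm_sq k (\<lambda>q. \<Sum>j\<in>UNIV. b j q * v j l))
      = (\<Sum>l<n. \<Sum>q<k. \<Sum>i\<in>UNIV. \<Sum>j\<in>UNIV. (v i l * cnj (v j l)) * (b i q * cnj (b j q)))"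
    unfolding norm_sq_def of_real_sum complex_norm_square cnj_sum sum_product by (simp add: mult_ac)
  also have "\<dots> = (\<Sum>l<n. \<Sum>i\<in>UNIV. \<Sum>q<k. \<Sum>j\<in>UNIV. (v i l * cnj (v j l)) * (b i q * cnj (b j q)))"
    by (intro sum.cong refl sum.swap)
  also have "\<dots> = (\<Sum>l<n. \<Sum>i\<in>UNIV. \<Sum>j\<in>UNIV. \<Sum>q<k. (v i l * cnj (v j l)) * (b i q * cnj (b j q)))"
    by (intro sum.cong refl sum.swap)
  also have "\<dots> = (\<Sum>i\<in>UNIV. \<Sum>l<n. \<Sum>j\<in>UNIV. \<Sum>q<k. (v i l * cnj (v j l)) * (b i q * cnj (b j q)))"
    by (rule sum.swap)
  also have "\<dots> = (\<Sum>i\<in>UNIV. \<Sum>j\<in>UNIV. \<Sum>l<n. \<Sum>q<k. (v i l * cnj (v j l)) * (b i q * cnj (b j q)))"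
    by (intro sum.cong refl sum.swap)
  also have "\<dots> = (\<Sum>i\<in>UNIV. \<Sum>j\<in>UNIV. gram n v $ i $ j * gram k b $ i $ j)"
    by (simp add: gram_def sum_product)
  finally have "Re (complex_of_real (\<Sum>l<n. norm_sq k (\<lambda>q. \<Sum>j\<in>UNIV. b j q * v j l)))
      = Re (\<Sum>i\<in>UNIV. \<Sum>j\<in>UNIV. gram n v $ i $ j * gram k b $ i $ j)"
    by (rule arg_cong)
  then show ?thesis by (simp only: Re_complex_of_real pairing_def)
qed

text \<open>
  The test function \<open>F\<close> is linear in \<open>z\<close>, with first row \<open>\<Sum>\<^sub>j z\<^sub>j b\<^sub>j\<close> and all other rows 0. Its norm is
  the supremum of \<open>\<parallel>\<Sum>\<^sub>j z\<^sub>j b\<^sub>j\<parallel>\<close>, at most 1 by the bound on the Gram matrix of \<open>b\<close>, while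
  the first row of its image has the pairing as its squared length.
\<close>
lemma pairing_le_cb_norm:
  fixes N :: "complex ^ 'm \<Rightarrow> real" and V :: "'m \<Rightarrow> complex mat" and b :: "'m \<Rightarrow> nat \<Rightarrow> complex"
  assumes N: "is_norm N" and k: "1 \<le> k" and b: "sesq_sup N (gram k b) \<le> 1"
  shows "ereal (sqrt (pairing (gram n (row_entries V)) (gram k b))) \<le> cb_norm (unit_ball N) n V"
proof -
  define F where "F z = Matrix.mat k k (\<lambda>(p, q). if p = 0 then lin_comb b z q else 0)" for z :: "complex ^ 'm"
  have Fc: "F z \<in> carrier_mat k k" for z by (simp add: F_def)
  have comb_lin: "(\<lambda>z. lin_comb b z q) = (\<lambda>z. \<Sum>j\<in>UNIV. (\<chi> j. b j q) $ j * z $ j)" for q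
    by (simp add: lin_comb_def mult.commute)
  have F: "F \<in> H_inf_mat k (unit_ball N)"
  proof -
    have "(\<lambda>z. F z $$ (p, q)) \<in> H_inf (unit_ball N)" if "p < k" "q < k" for p q
    proof (cases "p = 0")
      case True
      then have "(\<lambda>z. F z $$ (p, q)) = (\<lambda>z. lin_comb b z q)" using that by (simp add: F_def)
      then show ?thesis unfolding comb_lin by (simp only: linear_H_inf(1) [OF N])
    next
      case False
      then have "(\<lambda>z. F z $$ (p, q)) = (\<lambda>z. \<Sum>j\<in>UNIV. (0 :: complex ^ 'm) $ j * z $ j)"
        using that by (simp add: F_def)
      then show ?thesis by (simp only: linear_H_inf(1) [OF N])
    qed
    then show ?thesis by (simp add: H_inf_mat_def Fc)
  qed
  have Fn: "H_inf_mat_norm (unit_ball N) F \<le> 1"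
    unfolding H_inf_mat_norm_def
  proof (rule cSUP_least)
    show "unit_ball N \<noteq> {}" using is_norm_0 [OF N] by (auto simp: unit_ball_def intro!: exI [of _ 0])
    fix z assume "z \<in> unit_ball N"
    then have "N z \<le> 1" by (simp add: unit_ball_def)
    then have c1: "norm_sq k (lin_comb b z) \<le> 1" using norm_sq_lin_comb_le_on_ball [OF N, of z k b] b by simp
    show "op_norm (F z) \<le> 1"
    proof (rule op_norm_le [OF Fc])
      fix v :: "complex Matrix.vec" assume v: "v \<in> carrier_vec k"
      have Fv: "vec_index (F z *\<^sub>v v) p = (if p = 0 then cinner k (\<lambda>q. cnj (lin_comb b z q)) (vec_index v) else 0)"
        if "p < k" for p
        unfolding mult_mat_vec_index [OF Fc v that] using that by (simp add: F_def cinner_def)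
      have "(l2_norm (F z *\<^sub>v v))\<^sup>2 = (\<Sum>p<k. (cmod (vec_index (F z *\<^sub>v v) p))\<^sup>2)"
        unfolding l2_norm_sq norm_sq_def using Fc [of z] by simp
      also have "\<dots> = (\<Sum>p<k. if p = 0 then (cmod (cinner k (\<lambda>q. cnj (lin_comb b z q)) (vec_index v)))\<^sup>2 else 0)"
        by (intro sum.cong refl) (simp add: Fv del: index_mult_mat_vec)
      also have "\<dots> = (cmod (cinner k (\<lambda>q. cnj (lin_comb b z q)) (vec_index v)))\<^sup>2"
        using k by simp
      also have "\<dots> \<le> (sqrt (norm_sq k (\<lambda>q. cnj (lin_comb b z q))) * sqrt (norm_sq k (vec_index v)))\<^sup>2"
        by (intro power_mono cmod_cinner_le) simp
      also have "\<dots> = norm_sq k (lin_comb b z) * norm_sq k (vec_index v)"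
        by (simp add: power_mult_distrib) (simp add: norm_sq_def)
      also have "\<dots> \<le> 1 * norm_sq k (vec_index v)" using c1 by (intro mult_right_mono) auto
      also have "\<dots> = (l2_norm v)\<^sup>2" using v by (simp add: l2_norm_sq)
      finally show "l2_norm (F z *\<^sub>v v) \<le> 1 * l2_norm v" by simp
    qed simp
  qed
  have "partial_at_0 j (\<lambda>z. F z $$ (0, q)) = b j q" if "q < k" for j q
  proof -
    have "(\<lambda>z. F z $$ (0, q)) = (\<lambda>z. lin_comb b z q)" using that by (simp add: F_def)
    then show ?thesis unfolding comb_lin using linear_H_inf(2) [OF N, of j "\<chi> j. b j q"] by simp
  qed
  then have "(\<Sum>l<n. norm_sq k (\<lambda>q. \<Sum>j\<in>UNIV. partial_at_0 j (\<lambda>z. F z $$ (0, q)) * V j $$ (0, l)))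
      = (\<Sum>l<n. norm_sq k (\<lambda>q. \<Sum>j\<in>UNIV. b j q * row_entries V j l))"
    by (intro sum.cong refl norm_sq_cong) simp
  also have "\<dots> = pairing (gram n (row_entries V)) (gram k b)" by (rule sum_norm_sq_eq_pairing)
  finally have "pairing (gram n (row_entries V)) (gram k b) \<le> (op_norm (little_parrott_amp n V k F))\<^sup>2"
    using derivative_row_le_amp_op_norm [where n = n and F = F and V = V and k = k] k by simp
  then have "sqrt (pairing (gram n (row_entries V)) (gram k b)) \<le> op_norm (little_parrott_amp n V k F)"
    by (rule real_le_lsqrt [OF op_norm_nonneg [OF little_parrott_amp_carrier]])
  then have "ereal (sqrt (pairing (gram n (row_entries V)) (gram k b))) \<le> ereal (op_norm (little_parrott_amp n V k F))"
    by simp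
  also have "\<dots> \<le> little_parrott_amp_norm (unit_ball N) n V k"
    unfolding little_parrott_amp_norm_def using F Fn by (intro SUP_upper) auto
  also have "\<dots> \<le> cb_norm (unit_ball N) n V"
    unfolding cb_norm_def using k by (intro SUP_upper) auto
  finally show ?thesis .
qed

theorem theorem6p1:
  fixes N :: "complex ^ 'm \<Rightarrow> real"
  assumes "is_norm N"
  shows "(\<forall>n\<ge>1. \<forall>V :: 'm \<Rightarrow> complex mat. (\<forall>j. V j \<in> carrier_mat 1 n) \<longrightarrow>
            contractive (unit_ball N) n V \<longrightarrow>
            cb_norm (unit_ball N) n V \<le> ereal (sqrt (gamma_const N))) \<and>
         (\<exists>n\<ge>1. \<exists>V :: 'm \<Rightarrow> complex mat. (\<forall>j. V j \<in> carrier_mat 1 n) \<and>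
            contractive (unit_ball N) n V \<and>
            cb_norm (unit_ball N) n V = ereal (sqrt (gamma_const N)))"
proof -
  note N = assms
  have upper: "cb_norm (unit_ball N) n V \<le> ereal (sqrt (gamma_const N))"
    if "contractive (unit_ball N) n V" for n and V :: "'m \<Rightarrow> complex mat"
    unfolding cb_norm_def little_parrott_amp_norm_def
    using that unfolding contractive_iff [OF N]
    by (intro SUP_least) (auto intro: amp_op_norm_le_sqrt_gamma_const [OF N])
  obtain A B where AB: "psd A" "psd B" "sesq_sup (dual_norm N) A \<le> 1" "sesq_sup N B \<le> 1"
    "gamma_const N \<le> pairing A B"
    using gamma_const_attained [OF N] by blast
  define n where "n = CARD('m)"
  have n: "1 \<le> n" by (simp add: n_def Suc_le_eq)
  obtain v where "\<And>i j. A $ i $ j = (\<Sum>a<n. v i a * cnj (v j a))"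
    using psd_imp_gram [OF AB(1)] unfolding n_def by blast
  then have v: "A = gram n v"
    by (simp add: gram_def Finite_Cartesian_Product.vec_eq_iff)
  obtain b where "\<And>i j. B $ i $ j = (\<Sum>a<n. b i a * cnj (b j a))"
    using psd_imp_gram [OF AB(2)] unfolding n_def by blast
  then have b: "B = gram n b"
    by (simp add: gram_def Finite_Cartesian_Product.vec_eq_iff)
  define V :: "'m \<Rightarrow> complex mat" where "V j = Matrix.mat 1 n (\<lambda>(_, l). v j l)" for j
  have Vc: "V j \<in> carrier_mat 1 n" for j by (simp add: V_def)
  have gV: "gram n (row_entries V) = A"
    unfolding v gram_def by (simp add: V_def)
  have con: "contractive (unit_ball N) n V"
    using AB(3) unfolding contractive_iff [OF N] gV .
  have "ereal (sqrt (gamma_const N)) \<le> ereal (sqrt (pairing (gram n (row_entries V)) (gram n b)))"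
    using AB(5) unfolding gV b [symmetric] by simp
  also have "\<dots> \<le> cb_norm (unit_ball N) n V"
    using AB(4) unfolding b by (intro pairing_le_cb_norm [OF N n])
  finally have "cb_norm (unit_ball N) n V = ereal (sqrt (gamma_const N))"
    using upper [OF con] by (rule antisym [rotated])
  then have "\<exists>n\<ge>1. \<exists>V :: 'm \<Rightarrow> complex mat. (\<forall>j. V j \<in> carrier_mat 1 n) \<and>
      contractive (unit_ball N) n V \<and> cb_norm (unit_ball N) n V = ereal (sqrt (gamma_const N))"
    using n Vc con by (intro exI [of _ n] exI [of _ V] conjI allI)
  then show ?thesis using upper by (intro conjI allI impI)
qed

end
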